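(* Let $M$ be a von Neumann algebra with a faithful normal state $\varphi$, let $n\ge1$, and let $X=(x_1,\dots,x_n)\in M^n$ be an $n$-tuple of centered self-adjoint elements ($\varphi(x_i)=0$ for all $i$) satisfying $\sum_{i=1}^n\varphi(x_i^2)=n$. Then $$C_{opt}(X)\ge1+\frac{\Sigma^*\big(X\,\big|\,\frac12\sum_{i=1}^nt_i^2\big)^2}{n}.$$
   Context: $\mathcal{P}=\mathbb{C}\langle t_1,\dots,t_n\rangle$ is the algebra of noncommutative polynomials, with antilinear involution determined by $(PQ)^*=Q^*P^*$, $t_i^*=t_i$. The noncommutative derivatives $\partial_i:\mathcal{P}\to\mathcal{P}\otimes\mathcal{P}$ are the unique linear maps with $\partial_i(t_j)=\delta_{ij}\,1\otimes 1$ and $\partial_i(PQ)=\partial_i(P)\cdot Q+P\cdot\partial_i(Q)$, where $P_1\cdot(Q_1\otimes Q_2)\cdot P_2=(P_1Q_1)\otimes(Q_2P_2)$. The cyclic derivatives are $\mathcal{D}_i=m\circ\sigma\circ\partial_i$ with $\sigma(P\otimes Q)=Q\otimes P$, $m(P\otimes Q)=PQ$; the cyclic gradient of $V\in\mathcal{P}$ is $\mathcal{D}V=(\mathcal{D}_1V,\dots,\mathcal{D}_nV)$. For $P=(P_1,\dots,P_n)\in\mathcal{P}^n$ the Jacobian matrix is $\mathcal{J}P=(\partial_jP_i)_{i,j=1}^n\in M_n(\mathcal{P}\otimes\mathcal{P})$. Evaluation at $X$: $P(X)\in M$ is obtained by substituting $t_i\mapsto x_i$; elements of $\mathcal{P}\otimes\mathcal{P}$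 are evaluated in each leg and viewed in $M\otimes M^{op}$ ($M^{op}$ is $M$ with opposite multiplication, $\varphi^{op}$ is $\varphi$ viewed as a state on $M^{op}$); tuples and matrices are evaluated entrywise. Inner products: $\langle X,Y\rangle_\varphi=\sum_{i=1}^n\varphi(x_iy_i^* )$ on $M^n$, and $\langle A,B\rangle_{(\varphi\otimes\varphi^{op})\circ \mathrm{Tr}}=\sum_{i,j}(\varphi\otimes\varphi^{op})(a_{i,j}\cdot b_{i,j}^* )$ for matrices over $M\otimes M^{op}$, where $(a\otimes b)^*=a^*\otimes b^*$. The space $L^2(M_n(M\bar\otimes M^{op}),(\varphi\otimes\varphi^{op})\circ \mathrm{Tr})$ is the Hilbert space completion for the latter. $\|\cdot\|_2$ denotes the $L^2$-norms associated with $\varphi$ or with $\varphi\otimes\varphi^{op}$. A free Stein kernel for $X$ relative to $V\in\mathcal{P}$ is an $A$ in this $L^2$-space with $\langle[\mathcal{D}V](X),P(X)\rangle_\varphi=\langle A,[\mathcal{J}P](X)\rangle_{(\varphi\otimes\varphi^{op})\circ \mathrm{Tr}}$ for all $P\in\mathcal{P}^n$. The free Stein discrepancy is $\Sigma^*(X|V)=\inf_A\|A-(1\otimes1^{op})\otimes I_n\|$ (norm of this $L^2$-space), the infimum being over all free Stein kernels $A$ of $X$ relative to $V$; $(1\otimes1^{op})\otimes I_n$ is the diagonal matrix with entries $1\otimes1^{op}$. $X$ satisfies a free Poincaré inequality with constant $c$ if $\|P(X)-\varphi(P(X))\|_2^2\le c\sum_{i=1}^n\|[\partial_iP](X)\|_2^2$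 for all $P\in\mathcal{P}$; $C_{opt}(X)$ is the best (smallest) such constant. *)

theory Defs
  imports "HOL-Analysis.Analysis" "HOL-Library.Poly_Mapping"
begin

section \<open>Complex Hilbert spaces and von Neumann algebras\<close>

text \<open>The inner product is linear in the first argument.\<close>

class complex_hilbert_space = banach +
  fixes scaleC :: "complex \<Rightarrow> 'a \<Rightarrow> 'a" (infixr "*\<^sub>C" 75)
    and cinner :: "'a \<Rightarrow> 'a \<Rightarrow> complex"
  assumes scaleC_add_right: "c *\<^sub>C (x + y) = c *\<^sub>C x + c *\<^sub>C y"
    and scaleC_add_left: "(c + d) *\<^sub>C x = c *\<^sub>C x + d *\<^sub>C x"
    and scaleC_scaleC: "c *\<^sub>C d *\<^sub>C x = (c * d) *\<^sub>C x"
    and scaleC_of_real: "complex_of_real r *\<^sub>C x = r *\<^sub>R x"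
    and cinner_commute: "cinner y x = cnj (cinner x y)"
    and cinner_add_left: "cinner (x + y) z = cinner x z + cinner y z"
    and cinner_scaleC_left: "cinner (c *\<^sub>C x) y = c * cinner x y"
    and cinner_norm: "cinner x x = complex_of_real ((norm x)\<^sup>2)"

lemma norm_scaleC: "norm (c *\<^sub>C x) = cmod c * norm x"
  for x :: "'a::complex_hilbert_space"
proof -
  have "complex_of_real ((norm (c *\<^sub>C x))\<^sup>2) = c * cinner x (c *\<^sub>C x)"
    by (simp only: cinner_norm[symmetric] cinner_scaleC_left)
  also have "cinner x (c *\<^sub>C x) = cnj (c * cinner x x)"
    by (simp only: cinner_commute[of x "c *\<^sub>C x"] cinner_scaleC_left)
  also have "c * cnj (c * cinner x x) = (c * cnj c) * complex_of_real ((norm x)\<^sup>2)"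
    by (simp only: cinner_norm complex_cnj_mult complex_cnj_complex_of_real mult.assoc)
  also have "\<dots> = complex_of_real ((cmod c * norm x)\<^sup>2)"
    by (simp only: complex_norm_square[symmetric] of_real_mult[symmetric] power_mult_distrib)
  finally have "(norm (c *\<^sub>C x))\<^sup>2 = (cmod c * norm x)\<^sup>2"
    by (simp only: of_real_eq_iff)
  then show ?thesis by (simp add: power2_eq_iff_nonneg)
qed

lemma bounded_linear_scaleC:
  "bounded_linear (\<lambda>x::'a::complex_hilbert_space. c *\<^sub>C x)"
proof (rule bounded_linear_intro)
  show "c *\<^sub>C r *\<^sub>R x = r *\<^sub>R c *\<^sub>C x" for r and x :: 'a
    by (simp add: scaleC_scaleC mult.commute flip: scaleC_of_real)
  show "norm (c *\<^sub>C x) \<le> norm x * cmod c" for x :: 'a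
    by (simp add: norm_scaleC mult.commute)
qed (rule scaleC_add_right)

type_synonym 'h bop = "'h \<Rightarrow>\<^sub>L 'h"

definition op_scale :: "complex \<Rightarrow> 'h::complex_hilbert_space bop \<Rightarrow> 'h bop" where
  "op_scale c T = Blinfun (\<lambda>x. c *\<^sub>C blinfun_apply T x)"

lemma op_scale_apply: "blinfun_apply (op_scale c T) x = c *\<^sub>C blinfun_apply T x"
  unfolding op_scale_def
  by (subst bounded_linear_Blinfun_apply)
    (auto intro: bounded_linear_compose[OF bounded_linear_scaleC] blinfun.bounded_linear_right)

text \<open>\<^typ>\<open>'h bop\<close> contains all bounded \<^emph>\<open>real\<close>-linear operators; B(H) is the following subset.\<close>

definition bounded_operators :: "'h::complex_hilbert_space bop set" where
  "bounded_operators =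
    {T. \<forall>c x. blinfun_apply T (c *\<^sub>C x) = c *\<^sub>C blinfun_apply T x}"

definition is_op_adjoint :: "'h::complex_hilbert_space bop \<Rightarrow> 'h bop \<Rightarrow> bool" where
  "is_op_adjoint T S \<longleftrightarrow>
    (\<forall>x y. cinner (blinfun_apply T x) y = cinner x (blinfun_apply S y))"

definition op_adjoint :: "'h::complex_hilbert_space bop \<Rightarrow> 'h bop" where
  "op_adjoint T = (THE S. is_op_adjoint T S)"

definition self_adjoint :: "'h::complex_hilbert_space bop \<Rightarrow> bool" where
  "self_adjoint T \<longleftrightarrow> is_op_adjoint T T"

definition op_le :: "'h::complex_hilbert_space bop \<Rightarrow> 'h bop \<Rightarrow> bool" where
  "op_le S T \<longleftrightarrow> (\<forall>x. cinner (blinfun_apply (T - S) x) x \<in> \<real>\<^sub>\<ge>\<^sub>0)"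

definition commutant :: "'h::complex_hilbert_space bop set \<Rightarrow> 'h bop set" where
  "commutant A = {T \<in> bounded_operators. \<forall>S\<in>A. T o\<^sub>L S = S o\<^sub>L T}"

definition von_neumann_algebra :: "'h::complex_hilbert_space bop set \<Rightarrow> bool" where
  "von_neumann_algebra M \<longleftrightarrow>
    M \<subseteq> bounded_operators \<and>
    (\<forall>T\<in>M. \<exists>S\<in>M. is_op_adjoint T S) \<and>
    commutant (commutant M) = M"

text \<open>Functionals on \<open>M\<close> are functions on all operators whose values outside \<open>M\<close> are irrelevant.\<close>

definition state_on ::
  "'h::complex_hilbert_space bop set \<Rightarrow> ('h bop \<Rightarrow> complex) \<Rightarrow> bool" where
  "state_on M \<phi> \<longleftrightarrow>
    (\<forall>S\<in>M. \<forall>T\<in>M. \<phi> (S + T) = \<phi> S + \<phi> T) \<and>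
    (\<forall>c. \<forall>T\<in>M. \<phi> (op_scale c T) = c * \<phi> T) \<and>
    (\<forall>T\<in>M. \<phi> (op_adjoint T o\<^sub>L T) \<in> \<real>\<^sub>\<ge>\<^sub>0) \<and>
    \<phi> id_blinfun = 1"

definition faithful_on ::
  "'h::complex_hilbert_space bop set \<Rightarrow> ('h bop \<Rightarrow> complex) \<Rightarrow> bool" where
  "faithful_on M \<phi> \<longleftrightarrow> (\<forall>T\<in>M. \<phi> (op_adjoint T o\<^sub>L T) = 0 \<longrightarrow> T = 0)"

text \<open>Normality: suprema of upward directed bounded families of self-adjoint elements are preserved.\<close>

definition normal_on ::
  "'h::complex_hilbert_space bop set \<Rightarrow> ('h bop \<Rightarrow> complex) \<Rightarrow> bool" where
  "normal_on M \<phi> \<longleftrightarrow>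
    (\<forall>D S. D \<subseteq> {T \<in> M. self_adjoint T} \<and> D \<noteq> {} \<and>
      (\<forall>A\<in>D. \<forall>B\<in>D. \<exists>C\<in>D. op_le A C \<and> op_le B C) \<and>
      S \<in> M \<and> self_adjoint S \<and> (\<forall>A\<in>D. op_le A S) \<and>
      (\<forall>R\<in>M. self_adjoint R \<and> (\<forall>A\<in>D. op_le A R) \<longrightarrow> op_le S R)
      \<longrightarrow> \<phi> S = complex_of_real (SUP A\<in>D. Re (\<phi> A)))"


section \<open>Noncommutative polynomials\<close>

text \<open>
  Words form the free monoid.  It is written additively because the product that
  \<^theory>\<open>HOL-Library.Poly_Mapping\<close> puts on finitely supported functions is convolution over an
  additive monoid; thus \<open>'n nc_poly\<close> is the free unital algebra on the indeterminates \<open>t_i\<close>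
  (\<open>i :: 'n\<close>).  The pairs of words \<open>(u, v)\<close> stand for the basis \<open>u \<otimes> v\<close> of the tensor
  square, and the product of \<open>'n nc_poly2\<close> is the componentwise one,
  \<open>(P1 \<otimes> P2) (Q1 \<otimes> Q2) = P1 Q1 \<otimes> P2 Q2\<close>.
\<close>

datatype 'n nc_word = Word (letters: "'n list")

instantiation nc_word :: (type) monoid_add
begin
definition zero_nc_word :: "'a nc_word" where "0 = Word []"
definition plus_nc_word :: "'a nc_word \<Rightarrow> 'a nc_word \<Rightarrow> 'a nc_word" where
  "u + v = Word (letters u @ letters v)"
instance by standard (simp_all add: zero_nc_word_def plus_nc_word_def)
end

type_synonym 'n nc_poly = "'n nc_word \<Rightarrow>\<^sub>0 complex"
type_synonym 'n nc_poly2 = "('n nc_word \<times> 'n nc_word) \<Rightarrow>\<^sub>0 complex"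

definition pm_scale :: "complex \<Rightarrow> ('k \<Rightarrow>\<^sub>0 complex) \<Rightarrow> ('k \<Rightarrow>\<^sub>0 complex)" where
  "pm_scale c p = Poly_Mapping.map ((*) c) p"

text \<open>The linear extension of a map given on basis elements.\<close>

definition lin_ext ::
  "('k \<Rightarrow> ('l \<Rightarrow>\<^sub>0 complex)) \<Rightarrow> ('k \<Rightarrow>\<^sub>0 complex) \<Rightarrow> ('l \<Rightarrow>\<^sub>0 complex)" where
  "lin_ext f p = (\<Sum>k\<in>Poly_Mapping.keys p. pm_scale (Poly_Mapping.lookup p k) (f k))"

definition nc_var :: "'n \<Rightarrow> 'n nc_poly" where
  "nc_var i = Poly_Mapping.single (Word [i]) 1"

definition nc_tensor :: "'n nc_poly \<Rightarrow> 'n nc_poly \<Rightarrow> 'n nc_poly2" (infixr "\<otimes>\<^sub>P" 72) where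
  "P \<otimes>\<^sub>P Q = lin_ext (\<lambda>u. lin_ext (\<lambda>v. Poly_Mapping.single (u, v) 1) Q) P"

text \<open>The bimodule structure \<open>P1 \<cdot> (Q1 \<otimes> Q2) \<cdot> P2 = P1 Q1 \<otimes> Q2 P2\<close>.\<close>

definition nc_lact :: "'n nc_poly \<Rightarrow> 'n nc_poly2 \<Rightarrow> 'n nc_poly2" where
  "nc_lact P T = (P \<otimes>\<^sub>P 1) * T"

definition nc_ract :: "'n nc_poly2 \<Rightarrow> 'n nc_poly \<Rightarrow> 'n nc_poly2" where
  "nc_ract T P = T * (1 \<otimes>\<^sub>P P)"

definition is_nc_derivative :: "'n \<Rightarrow> ('n nc_poly \<Rightarrow> 'n nc_poly2) \<Rightarrow> bool" where
  "is_nc_derivative i D \<longleftrightarrow>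
    (\<forall>P Q. D (P + Q) = D P + D Q) \<and>
    (\<forall>c P. D (pm_scale c P) = pm_scale c (D P)) \<and>
    (\<forall>j. D (nc_var j) = (if i = j then 1 \<otimes>\<^sub>P 1 else 0)) \<and>
    (\<forall>P Q. D (P * Q) = nc_ract (D P) Q + nc_lact P (D Q))"

definition nc_deriv :: "'n \<Rightarrow> 'n nc_poly \<Rightarrow> 'n nc_poly2" where
  "nc_deriv i = (THE D. is_nc_derivative i D)"

definition nc_flip :: "'n nc_poly2 \<Rightarrow> 'n nc_poly2" where
  "nc_flip = lin_ext (\<lambda>(u, v). Poly_Mapping.single (v, u) 1)"

definition nc_mult :: "'n nc_poly2 \<Rightarrow> 'n nc_poly" where
  "nc_mult = lin_ext (\<lambda>(u, v). Poly_Mapping.single (u + v) 1)"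

definition cyclic_deriv :: "'n \<Rightarrow> 'n nc_poly \<Rightarrow> 'n nc_poly" where
  "cyclic_deriv i = nc_mult \<circ> nc_flip \<circ> nc_deriv i"

definition cyclic_gradient :: "'n::finite nc_poly \<Rightarrow> 'n nc_poly ^ 'n" where
  "cyclic_gradient V = (\<chi> i. cyclic_deriv i V)"

definition jacobian :: "'n::finite nc_poly ^ 'n \<Rightarrow> 'n nc_poly2 ^ 'n ^ 'n" where
  "jacobian P = (\<chi> i j. nc_deriv j (P $ i))"

subsection \<open>Existence and uniqueness of the noncommutative derivatives\<close>

lemma lookup_pm_scale [simp]:
  "Poly_Mapping.lookup (pm_scale c p) k = c * Poly_Mapping.lookup p k"
  by (simp add: pm_scale_def map.rep_eq when_def)

lemma pm_scale_simps [simp]: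
  "pm_scale c (p + q) = pm_scale c p + pm_scale c q"
  "pm_scale (c + d) p = pm_scale c p + pm_scale d p"
  "pm_scale c (pm_scale d p) = pm_scale (c * d) p"
  "pm_scale 0 p = 0" "pm_scale c 0 = 0" "pm_scale 1 p = p"
  "pm_scale c (Poly_Mapping.single k d) = Poly_Mapping.single k (c * d)"
  by (auto intro!: poly_mapping_eqI simp: lookup_add lookup_single algebra_simps when_def)

lemma lin_ext_superset:
  assumes "finite K" "Poly_Mapping.keys p \<subseteq> K"
  shows "lin_ext f p = (\<Sum>k\<in>K. pm_scale (Poly_Mapping.lookup p k) (f k))"
  unfolding lin_ext_def by (rule sum.mono_neutral_left) (use assms in \<open>auto simp: in_keys_iff\<close>)

lemma lin_ext_add: "lin_ext f (p + q) = lin_ext f p + lin_ext f q"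
proof -
  let ?K = "Poly_Mapping.keys p \<union> Poly_Mapping.keys q"
  have "finite ?K" "Poly_Mapping.keys (p + q) \<subseteq> ?K" by (auto simp: keys_add)
  then show ?thesis
    by (simp add: lin_ext_superset[of ?K] lookup_add sum.distrib)
qed

lemma pm_scale_sum: "pm_scale c (sum f A) = (\<Sum>a\<in>A. pm_scale c (f a))"
  by (induction A rule: infinite_finite_induct) simp_all

lemma lin_ext_scale: "lin_ext f (pm_scale c p) = pm_scale c (lin_ext f p)"
proof -
  have "Poly_Mapping.keys (pm_scale c p) \<subseteq> Poly_Mapping.keys p" by (auto simp: in_keys_iff)
  then show ?thesis
    by (simp add: lin_ext_superset[of "Poly_Mapping.keys p"] pm_scale_sum)
qed

lemma lin_ext_zero [simp]: "lin_ext f 0 = 0"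
  by (simp add: lin_ext_def)

lemma lin_ext_single [simp]: "lin_ext f (Poly_Mapping.single k c) = pm_scale c (f k)"
  by (simp add: lin_ext_superset[of "{k}"])

lemma pm_induct [case_names zero single add]:
  fixes p :: "'k \<Rightarrow>\<^sub>0 complex"
  assumes "Q 0" "\<And>k c. Q (Poly_Mapping.single k c)" "\<And>p q. Q p \<Longrightarrow> Q q \<Longrightarrow> Q (p + q)"
  shows "Q p"
proof -
  have "Q (\<Sum>k\<in>A. Poly_Mapping.single k (Poly_Mapping.lookup p k))" if "finite A" for A
    using that by (induction A) (auto intro: assms)
  moreover have "p = (\<Sum>k\<in>Poly_Mapping.keys p. Poly_Mapping.single k (Poly_Mapping.lookup p k))"
    by (rule poly_mapping_eqI) (auto simp: lookup_sum lookup_single when_def in_keys_iff)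
  ultimately show ?thesis by (metis finite_keys)
qed

lemma nc_tensor_add_left: "(P + P') \<otimes>\<^sub>P Q = P \<otimes>\<^sub>P Q + P' \<otimes>\<^sub>P Q"
  by (simp add: nc_tensor_def lin_ext_add)

lemma nc_tensor_add_right: "P \<otimes>\<^sub>P (Q + Q') = P \<otimes>\<^sub>P Q + P \<otimes>\<^sub>P Q'"
  by (simp add: nc_tensor_def lin_ext_add lin_ext_def[of _ P] sum.distrib)

lemma nc_tensor_single:
  "Poly_Mapping.single u c \<otimes>\<^sub>P Poly_Mapping.single v d = Poly_Mapping.single (u, v) (c * d)"
  by (simp add: nc_tensor_def)

lemma nc_tensor_zero [simp]: "0 \<otimes>\<^sub>P Q = 0" "P \<otimes>\<^sub>P 0 = 0"
  by (simp_all add: nc_tensor_def lin_ext_def)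

lemma nc_tensor_one_one: "(1 :: 'n nc_poly) \<otimes>\<^sub>P 1 = 1"
  by (metis nc_tensor_single single_one mult_1 zero_prod_def)

primrec word_deriv :: "'n \<Rightarrow> 'n list \<Rightarrow> 'n nc_poly2" where
  "word_deriv i [] = 0"
| "word_deriv i (x # w) =
    (if i = x then Poly_Mapping.single (0, Word w) 1 else 0)
      + Poly_Mapping.single (Word [x], 0) 1 * word_deriv i w"

lemma word_deriv_append:
  "word_deriv i (u @ v) = word_deriv i u * Poly_Mapping.single (0, Word v) 1
    + Poly_Mapping.single (Word u, 0) 1 * word_deriv i v"
proof (induction u)
  case Nil
  have "Poly_Mapping.single (Word [], 0) 1 = (1 :: 'a nc_poly2)"
    by (metis single_one zero_nc_word_def zero_prod_def)
  then show ?case by simp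
next
  case (Cons x u)
  have 1: "Poly_Mapping.single (Word [x], 0) 1 * Poly_Mapping.single (Word u, 0) 1
      = (Poly_Mapping.single (Word (x # u), 0) 1 :: 'a nc_poly2)"
    and 2: "Poly_Mapping.single (0, Word u) 1 * Poly_Mapping.single (0, Word v) 1
      = (Poly_Mapping.single (0, Word (u @ v)) 1 :: 'a nc_poly2)"
    by (simp_all add: mult_single) (simp_all add: plus_nc_word_def)
  show ?case
    by (simp add: Cons.IH distrib_left distrib_right mult.assoc flip: 1 2)
qed

lemma pm_scale_eq_mult: "pm_scale c p = Poly_Mapping.single 0 c * p"
  for p :: "'k::monoid_add \<Rightarrow>\<^sub>0 complex"
  by (induction p rule: pm_induct) (simp_all add: mult_single distrib_left)

lemma pm_scale_eq_mult': "pm_scale c p = p * Poly_Mapping.single 0 c"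
  for p :: "'k::monoid_add \<Rightarrow>\<^sub>0 complex"
  by (induction p rule: pm_induct) (simp_all add: mult_single distrib_right mult.commute)

lemma pm_scale_mult_left: "pm_scale c p * q = pm_scale c (p * q)"
  for p :: "'k::monoid_add \<Rightarrow>\<^sub>0 complex"
  by (simp add: pm_scale_eq_mult mult.assoc)

lemma pm_scale_mult_right: "p * pm_scale c q = pm_scale c (p * q)"
  for p :: "'k::monoid_add \<Rightarrow>\<^sub>0 complex"
  by (simp add: pm_scale_eq_mult' mult.assoc)

lemma lin_ext_word_deriv: "is_nc_derivative i (lin_ext (\<lambda>w. word_deriv i (letters w)))"
  (is "is_nc_derivative i ?D")
proof -
  have leib: "?D (P * Q) = nc_ract (?D P) Q + nc_lact P (?D Q)" for P Q
  proof (induction P rule: pm_induct)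
    case (single u c)
    show ?case
    proof (induction Q rule: pm_induct)
      case (single v d)
      have 1: "(1 :: 'a nc_poly) = Poly_Mapping.single 0 1" by simp
      have 2: "Poly_Mapping.single (u, 0) c = pm_scale c (Poly_Mapping.single (u, 0) 1)"
          "Poly_Mapping.single (0, v) d = pm_scale d (Poly_Mapping.single (0, v) 1)"
        by simp_all
      show ?case
        unfolding 1 nc_ract_def nc_lact_def nc_tensor_single mult_1 mult_1_right
        unfolding 2 mult_single lin_ext_single pm_scale_mult_left pm_scale_mult_right
        by (cases u; cases v) (simp add: plus_nc_word_def word_deriv_append mult.commute)
    next
      case (add P Q)
      then show ?case
        by (simp add: lin_ext_add nc_ract_def nc_lact_def nc_tensor_add_right algebra_simps)
    qed (simp add: nc_ract_def nc_lact_def)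
  next
    case (add P Q)
    then show ?case
      by (simp add: lin_ext_add nc_ract_def nc_lact_def nc_tensor_add_left algebra_simps)
  qed (simp add: nc_ract_def nc_lact_def)
  have "(Poly_Mapping.single (0, Word []) 1 :: 'a nc_poly2) = 1"
    by (metis single_one zero_nc_word_def zero_prod_def)
  then show ?thesis
    unfolding is_nc_derivative_def
    by (auto simp: leib lin_ext_add lin_ext_scale nc_var_def nc_tensor_one_one)
qed

lemma is_nc_derivativeD:
  assumes "is_nc_derivative i D"
  shows "D (P + Q) = D P + D Q" "D (pm_scale c P) = pm_scale c (D P)"
    "D (nc_var j) = (if i = j then 1 \<otimes>\<^sub>P 1 else 0)"
    "D (P * Q) = nc_ract (D P) Q + nc_lact P (D Q)"
  using assms unfolding is_nc_derivative_def by blast+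

lemma is_nc_derivative_one:
  assumes "is_nc_derivative i D"
  shows "D 1 = 0"
proof -
  have "D 1 = D 1 + D 1"
    using is_nc_derivativeD(4)[OF assms, of 1 1]
    by (simp only: nc_ract_def nc_lact_def nc_tensor_one_one mult_1 mult_1_right)
  then show ?thesis by simp
qed

lemma is_nc_derivative_unique:
  assumes D: "is_nc_derivative i D" and E: "is_nc_derivative i E"
  shows "D = E"
proof
  have words: "D (Poly_Mapping.single (Word w) 1) = E (Poly_Mapping.single (Word w) 1)" for w
  proof (induction w)
    case Nil
    have "Poly_Mapping.single (Word []) 1 = (1 :: 'a nc_poly)"
      by (simp only: zero_nc_word_def[symmetric] single_one)
    then show ?case by (simp only: is_nc_derivative_one[OF D] is_nc_derivative_one[OF E])
  next
    case (Cons x w)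
    have "Poly_Mapping.single (Word (x # w)) 1 = nc_var x * Poly_Mapping.single (Word w) 1"
      by (simp add: nc_var_def mult_single plus_nc_word_def)
    then show ?case
      by (simp only: is_nc_derivativeD(3,4)[OF D] is_nc_derivativeD(3,4)[OF E] Cons.IH)
  qed
  show "D P = E P" for P
  proof (induction P rule: pm_induct)
    case zero
    show ?case
      using is_nc_derivativeD(2)[OF D, of 0 0] is_nc_derivativeD(2)[OF E, of 0 0]
      by (simp only: pm_scale_simps(4))
  next
    case (single u c)
    have "Poly_Mapping.single u c = pm_scale c (Poly_Mapping.single (Word (letters u)) 1)"
      by simp
    then show ?case
      by (simp only: is_nc_derivativeD(2)[OF D] is_nc_derivativeD(2)[OF E] words)
  next
    case (add P Q)
    then show ?case
      by (simp only: is_nc_derivativeD(1)[OF D] is_nc_derivativeD(1)[OF E])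
  qed
qed

lemma nc_deriv_eq: "nc_deriv i = lin_ext (\<lambda>w. word_deriv i (letters w))"
  unfolding nc_deriv_def
  by (rule the_equality)
    (rule lin_ext_word_deriv, erule is_nc_derivative_unique[OF _ lin_ext_word_deriv])

lemma nc_deriv: "is_nc_derivative i (nc_deriv i)"
  by (simp only: nc_deriv_eq lin_ext_word_deriv)


section \<open>Hilbert space completion\<close>

text \<open>
  The Hausdorff completion of a complex vector space \<open>E\<close> with positive semidefinite sesquilinear form
  \<open>ip\<close>: Cauchy sequences in \<open>E\<close> modulo sequences converging to zero.  Vectors of length zero
  are thereby identified with zero.
\<close>

definition form_norm :: "('e \<Rightarrow> 'e \<Rightarrow> complex) \<Rightarrow> 'e \<Rightarrow> real" where
  "form_norm ip a = sqrt (Re (ip a a))"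

definition form_cauchy ::
  "'e::ab_group_add set \<Rightarrow> ('e \<Rightarrow> 'e \<Rightarrow> complex) \<Rightarrow> (nat \<Rightarrow> 'e) set" where
  "form_cauchy E ip =
    {s. (\<forall>k. s k \<in> E) \<and> (\<forall>e>0. \<exists>N. \<forall>k\<ge>N. \<forall>l\<ge>N. form_norm ip (s k - s l) < e)}"

definition form_rel ::
  "'e::ab_group_add set \<Rightarrow> ('e \<Rightarrow> 'e \<Rightarrow> complex) \<Rightarrow> ((nat \<Rightarrow> 'e) \<times> (nat \<Rightarrow> 'e)) set" where
  "form_rel E ip = {(s, t). s \<in> form_cauchy E ip \<and> t \<in> form_cauchy E ip \<and>
    (\<lambda>k. form_norm ip (s k - t k)) \<longlonglongrightarrow> 0}"

definition completion ::
  "'e::ab_group_add set \<Rightarrow> ('e \<Rightarrow> 'e \<Rightarrow> complex) \<Rightarrow> (nat \<Rightarrow> 'e) set set" where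
  "completion E ip = form_cauchy E ip // form_rel E ip"

definition completion_embed ::
  "'e::ab_group_add set \<Rightarrow> ('e \<Rightarrow> 'e \<Rightarrow> complex) \<Rightarrow> 'e \<Rightarrow> (nat \<Rightarrow> 'e) set" where
  "completion_embed E ip a = form_rel E ip `` {\<lambda>_. a}"

definition completion_diff ::
  "'e::ab_group_add set \<Rightarrow> ('e \<Rightarrow> 'e \<Rightarrow> complex)
    \<Rightarrow> (nat \<Rightarrow> 'e) set \<Rightarrow> (nat \<Rightarrow> 'e) set \<Rightarrow> (nat \<Rightarrow> 'e) set" where
  "completion_diff E ip A B = (\<Union>s\<in>A. \<Union>t\<in>B. form_rel E ip `` {\<lambda>k. s k - t k})"

definition completion_inner ::
  "('e \<Rightarrow> 'e \<Rightarrow> complex) \<Rightarrow> (nat \<Rightarrow> 'e) set \<Rightarrow> (nat \<Rightarrow> 'e) set \<Rightarrow> complex" where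
  "completion_inner ip A B = (THE l. \<forall>s\<in>A. \<forall>t\<in>B. (\<lambda>k. ip (s k) (t k)) \<longlonglongrightarrow> l)"

definition completion_norm ::
  "('e \<Rightarrow> 'e \<Rightarrow> complex) \<Rightarrow> (nat \<Rightarrow> 'e) set \<Rightarrow> real" where
  "completion_norm ip A = sqrt (Re (completion_inner ip A A))"


section \<open>The tensor product of \<open>M\<close> and its opposite\<close>

text \<open>
  An element \<open>\<Sum>k. c k \<cdot> (a k \<otimes> b k)\<close> of the algebraic tensor product is represented by the formal
  linear combination \<open>\<Sum>k. c k \<cdot> (a k, b k)\<close>.  Representatives are not unique, but all
  operations below respect the tensor relations.  On the algebraic tensor product the sesquilinear
  form is definite, because the state is faithful, so the vectors of length zero among the formal
  linear combinations are exactly the combinations of tensor relations, and passing to the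
  completion above also carries out the quotient by these relations.
\<close>

type_synonym 'h tensor_rep = "('h bop \<times> 'h bop) \<Rightarrow>\<^sub>0 complex"

text \<open>\<open>(a \<otimes> b) (c \<otimes> d) = a c \<otimes> d b\<close>, the second leg carrying the opposite multiplication.\<close>

definition tensor_mult ::
  "'h::complex_hilbert_space tensor_rep \<Rightarrow> 'h tensor_rep \<Rightarrow> 'h tensor_rep" where
  "tensor_mult s t =
    lin_ext (\<lambda>(a, b). lin_ext (\<lambda>(c, d). Poly_Mapping.single (a o\<^sub>L c, d o\<^sub>L b) 1) t) s"

definition tensor_star :: "'h::complex_hilbert_space tensor_rep \<Rightarrow> 'h tensor_rep" where
  "tensor_star s = (\<Sum>(a, b)\<in>Poly_Mapping.keys s.
    Poly_Mapping.single (op_adjoint a, op_adjoint b) (cnj (Poly_Mapping.lookup s (a, b))))"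

definition tensor_state ::
  "('h::complex_hilbert_space bop \<Rightarrow> complex) \<Rightarrow> 'h tensor_rep \<Rightarrow> complex" where
  "tensor_state \<phi> s =
    (\<Sum>(a, b)\<in>Poly_Mapping.keys s. Poly_Mapping.lookup s (a, b) * \<phi> a * \<phi> b)"

definition tensor_algebra :: "'h::complex_hilbert_space bop set \<Rightarrow> 'h tensor_rep set" where
  "tensor_algebra M = {s. Poly_Mapping.keys s \<subseteq> M \<times> M}"

definition tensor_norm2 ::
  "('h::complex_hilbert_space bop \<Rightarrow> complex) \<Rightarrow> 'h tensor_rep \<Rightarrow> real" where
  "tensor_norm2 \<phi> s = sqrt (Re (tensor_state \<phi> (tensor_mult s (tensor_star s))))"

definition tensor_matrices ::
  "'h::complex_hilbert_space bop set \<Rightarrow> ('h tensor_rep ^ 'n::finite ^ 'n) set" where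
  "tensor_matrices M = {A. \<forall>i j. A $ i $ j \<in> tensor_algebra M}"

definition matrix_inner ::
  "('h::complex_hilbert_space bop \<Rightarrow> complex)
    \<Rightarrow> 'h tensor_rep ^ 'n::finite ^ 'n \<Rightarrow> 'h tensor_rep ^ 'n ^ 'n \<Rightarrow> complex" where
  "matrix_inner \<phi> A B =
    (\<Sum>i\<in>UNIV. \<Sum>j\<in>UNIV. tensor_state \<phi> (tensor_mult (A $ i $ j) (tensor_star (B $ i $ j))))"

definition matrix_id :: "'h::complex_hilbert_space tensor_rep ^ 'n::finite ^ 'n" where
  "matrix_id = (\<chi> i j. if i = j then Poly_Mapping.single (id_blinfun, id_blinfun) 1 else 0)"

definition L2_matrices ::
  "'h::complex_hilbert_space bop set \<Rightarrow> ('h bop \<Rightarrow> complex)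
    \<Rightarrow> (nat \<Rightarrow> 'h tensor_rep ^ 'n::finite ^ 'n) set set" where
  "L2_matrices M \<phi> = completion (tensor_matrices M) (matrix_inner \<phi>)"

definition op_norm2 :: "('h::complex_hilbert_space bop \<Rightarrow> complex) \<Rightarrow> 'h bop \<Rightarrow> real" where
  "op_norm2 \<phi> T = sqrt (Re (\<phi> (T o\<^sub>L op_adjoint T)))"

definition tuple_inner ::
  "('h::complex_hilbert_space bop \<Rightarrow> complex) \<Rightarrow> 'h bop ^ 'n::finite \<Rightarrow> 'h bop ^ 'n \<Rightarrow> complex" where
  "tuple_inner \<phi> X Y = (\<Sum>i\<in>UNIV. \<phi> (X $ i o\<^sub>L op_adjoint (Y $ i)))"


section \<open>Evaluation, free Stein kernels and the free Poincare inequality\<close>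

definition word_eval ::
  "'h::complex_hilbert_space bop ^ 'n::finite \<Rightarrow> 'n nc_word \<Rightarrow> 'h bop" where
  "word_eval X w = foldr (\<lambda>i T. X $ i o\<^sub>L T) (letters w) id_blinfun"

definition nc_eval ::
  "'h::complex_hilbert_space bop ^ 'n::finite \<Rightarrow> 'n nc_poly \<Rightarrow> 'h bop" where
  "nc_eval X P =
    (\<Sum>w\<in>Poly_Mapping.keys P. op_scale (Poly_Mapping.lookup P w) (word_eval X w))"

definition nc_eval2 ::
  "'h::complex_hilbert_space bop ^ 'n::finite \<Rightarrow> 'n nc_poly2 \<Rightarrow> 'h tensor_rep" where
  "nc_eval2 X = lin_ext (\<lambda>(u, v). Poly_Mapping.single (word_eval X u, word_eval X v) 1)"

definition eval_tuple ::
  "'h::complex_hilbert_space bop ^ 'n::finite \<Rightarrow> 'n nc_poly ^ 'n \<Rightarrow> 'h bop ^ 'n" where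
  "eval_tuple X P = (\<chi> i. nc_eval X (P $ i))"

definition eval_matrix ::
  "'h::complex_hilbert_space bop ^ 'n::finite \<Rightarrow> 'n nc_poly2 ^ 'n ^ 'n
    \<Rightarrow> 'h tensor_rep ^ 'n ^ 'n" where
  "eval_matrix X A = (\<chi> i j. nc_eval2 X (A $ i $ j))"

definition free_stein_kernel ::
  "'h::complex_hilbert_space bop set \<Rightarrow> ('h bop \<Rightarrow> complex) \<Rightarrow> 'h bop ^ 'n::finite
    \<Rightarrow> 'n nc_poly \<Rightarrow> (nat \<Rightarrow> 'h tensor_rep ^ 'n ^ 'n) set \<Rightarrow> bool" where
  "free_stein_kernel M \<phi> X V A \<longleftrightarrow>
    A \<in> L2_matrices M \<phi> \<and>
    (\<forall>P. tuple_inner \<phi> (eval_tuple X (cyclic_gradient V)) (eval_tuple X P) =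
      completion_inner (matrix_inner \<phi>) A
        (completion_embed (tensor_matrices M) (matrix_inner \<phi>) (eval_matrix X (jacobian P))))"

text \<open>The infimum is \<open>\<infinity>\<close> if there is no free Stein kernel.\<close>

definition free_stein_discrepancy ::
  "'h::complex_hilbert_space bop set \<Rightarrow> ('h bop \<Rightarrow> complex) \<Rightarrow> 'h bop ^ 'n::finite
    \<Rightarrow> 'n nc_poly \<Rightarrow> ereal" where
  "free_stein_discrepancy M \<phi> X V =
    (INF A\<in>{A. free_stein_kernel M \<phi> X V A}.
      ereal (completion_norm (matrix_inner \<phi>)
        (completion_diff (tensor_matrices M) (matrix_inner \<phi>) A
          (completion_embed (tensor_matrices M) (matrix_inner \<phi>) matrix_id))))"

definition free_poincare ::
  "('h::complex_hilbert_space bop \<Rightarrow> complex) \<Rightarrow> 'h bop ^ 'n::finite \<Rightarrow> real \<Rightarrow> bool" where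
  "free_poincare \<phi> X c \<longleftrightarrow>
    (\<forall>P. (op_norm2 \<phi> (nc_eval X P - op_scale (\<phi> (nc_eval X P)) id_blinfun))\<^sup>2
      \<le> c * (\<Sum>i\<in>UNIV. (tensor_norm2 \<phi> (nc_eval2 X (nc_deriv i P)))\<^sup>2))"

text \<open>The value is \<open>\<infinity>\<close> if no free Poincare inequality holds.\<close>

definition C_opt ::
  "('h::complex_hilbert_space bop \<Rightarrow> complex) \<Rightarrow> 'h bop ^ 'n::finite \<Rightarrow> ereal" where
  "C_opt \<phi> X = (INF c\<in>{c. free_poincare \<phi> X c}. ereal c)"

end

theory Submission
  imports Defs
begin

text \<open>
  Let \<open>c\<close> be a constant in the free Poincare inequality of \<open>X\<close>.  The quadratic potential has cyclic
  gradient \<open>t = (t\<^sub>1, \<dots>, t\<^sub>n)\<close>, so a free Stein kernel is an \<open>A\<close> with \<open>\<langle>X, P(X)\<rangle> = \<langle>A, [JP](X)\<rangle>\<close> for all \<open>P\<close>.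
  Because \<open>X\<close> is centered, \<open>P(X)\<close> may be centered in the left-hand side; Cauchy-Schwarz, the Poincare
  inequality in each entry and \<open>\<langle>X, X\<rangle> = n\<close> then give \<open>\<bar>\<langle>X, P(X)\<rangle>\<bar>\<^sup>2 \<le> n * c * \<parallel>[JP](X)\<parallel>\<^sup>2\<close>
  (\<open>tuple_inner_poincare_bound\<close>).  Thus the left-hand side is a bounded functional of the Jacobian, and
  the Riesz theorem (\<open>riesz_sequence\<close>) yields a free Stein kernel \<open>A\<close> with \<open>\<parallel>A\<parallel>\<^sup>2 \<le> n * c\<close>.

  The unit matrix \<open>I\<close> is the Jacobian of \<open>t\<close>, so the kernel identity itself gives \<open>\<langle>A, I\<rangle> = \<langle>X, X\<rangle> = n = \<parallel>I\<parallel>\<^sup>2\<close>.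
  Hence \<open>\<parallel>A - I\<parallel>\<^sup>2 = \<parallel>A\<parallel>\<^sup>2 - n \<le> n * (c - 1)\<close> (\<open>stein_kernel_of_poincare\<close>), and the squared discrepancy is at
  most \<open>n * (c - 1)\<close> for every admissible \<open>c\<close>.

  The analytic input is that the form on matrices over \<open>M \<otimes> M\<^sup>o\<^sup>p\<close> is positive semidefinite, without which
  neither the completion nor the Riesz theorem makes sense.  On formal combinations of elementary
  tensors it is given by the entrywise product of two Gram kernels, one for \<open>\<phi> (a b\<^sup>*)\<close> and one for
  \<open>\<phi> (b\<^sup>* a)\<close>, so positivity is the Schur product theorem (\<open>schur_product\<close>,
  \<open>semi_inner_space_tensor\<close>).
\<close>

section \<open>Positive semidefinite forms\<close>

text \<open>
  Tuples over \<open>M\<close>, formal tensors, matrices of tensors and tuples of polynomials all carry a positive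
  semidefinite form, and each of them needs Cauchy-Schwarz or a completion.  The carrier is a set
  because the form on formal tensors is Hermitian and positive only for legs in \<open>M\<close>.  The scalar
  multiplication is a parameter because none of these types has a complex vector space structure in
  its type class.
\<close>

locale semi_inner_space =
  fixes E :: "'e::ab_group_add set"
    and sc :: "complex \<Rightarrow> 'e \<Rightarrow> 'e"
    and ip :: "'e \<Rightarrow> 'e \<Rightarrow> complex"
  assumes zero_mem: "0 \<in> E"
    and add_mem: "a \<in> E \<Longrightarrow> b \<in> E \<Longrightarrow> a + b \<in> E"
    and minus_mem: "a \<in> E \<Longrightarrow> - a \<in> E"
    and sc_mem: "a \<in> E \<Longrightarrow> sc z a \<in> E"
    and ip_add_left: "a \<in> E \<Longrightarrow> b \<in> E \<Longrightarrow> c \<in> E \<Longrightarrow> ip (a + b) c = ip a c + ip b c"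
    and ip_sc_left: "a \<in> E \<Longrightarrow> b \<in> E \<Longrightarrow> ip (sc z a) b = z * ip a b"
    and ip_commute: "a \<in> E \<Longrightarrow> b \<in> E \<Longrightarrow> ip b a = cnj (ip a b)"
    and ip_nonneg: "a \<in> E \<Longrightarrow> 0 \<le> Re (ip a a)"
begin

lemma diff_mem: "a \<in> E \<Longrightarrow> b \<in> E \<Longrightarrow> a - b \<in> E"
  using add_mem[of a "- b"] minus_mem[of b] by simp

lemma ip_add_right:
  assumes "a \<in> E" "b \<in> E" "c \<in> E"
  shows "ip c (a + b) = ip c a + ip c b"
  using assms by (simp add: ip_commute[of _ c] add_mem ip_add_left)

lemma ip_sc_right:
  assumes "a \<in> E" "b \<in> E"
  shows "ip a (sc z b) = cnj z * ip a b"
  using assms by (simp add: ip_commute[of _ a] sc_mem ip_sc_left)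

lemma ip_diff_left:
  assumes "a \<in> E" "b \<in> E" "c \<in> E"
  shows "ip (a - b) c = ip a c - ip b c"
  using ip_add_left[of "a - b" b c] assms diff_mem by simp

lemma ip_diff_right:
  assumes "a \<in> E" "b \<in> E" "c \<in> E"
  shows "ip c (a - b) = ip c a - ip c b"
  using assms by (simp add: ip_commute[of _ c] diff_mem ip_diff_left)

lemma ip_zero_left: "a \<in> E \<Longrightarrow> ip 0 a = 0"
  using ip_add_left[of 0 0 a] zero_mem by simp

lemma ip_zero_right: "a \<in> E \<Longrightarrow> ip a 0 = 0"
  using ip_commute[of 0 a] by (simp add: ip_zero_left zero_mem)

lemma ip_self: "a \<in> E \<Longrightarrow> ip a a = complex_of_real (Re (ip a a))"
  using ip_commute[of a a] by (simp add: complex_eq_iff)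

lemma sum_mem: "(\<And>k. k \<in> K \<Longrightarrow> a k \<in> E) \<Longrightarrow> (\<Sum>k\<in>K. a k) \<in> E"
  by (induction K rule: infinite_finite_induct) (auto simp: zero_mem add_mem)

lemma ip_sum_left:
  assumes "\<And>k. k \<in> K \<Longrightarrow> a k \<in> E" "b \<in> E"
  shows "ip (\<Sum>k\<in>K. a k) b = (\<Sum>k\<in>K. ip (a k) b)"
  using assms
  by (induction K rule: infinite_finite_induct) (auto simp: ip_zero_left ip_add_left sum_mem)

lemma ip_sum_right:
  assumes "\<And>k. k \<in> K \<Longrightarrow> a k \<in> E" "b \<in> E"
  shows "ip b (\<Sum>k\<in>K. a k) = (\<Sum>k\<in>K. ip b (a k))"
  using assms
  by (induction K rule: infinite_finite_induct) (auto simp: ip_zero_right ip_add_right sum_mem)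

lemma Re_ip_add_sc:
  assumes "a \<in> E" "b \<in> E"
  shows "Re (ip (a + sc z b) (a + sc z b)) =
    Re (ip a a) + 2 * Re (cnj z * ip a b) + (cmod z)\<^sup>2 * Re (ip b b)"
proof -
  have "ip (a + sc z b) (a + sc z b) =
      ip a a + (cnj z * ip a b + cnj (cnj z * ip a b)) + (z * cnj z) * ip b b"
    using assms by (simp add: ip_add_left ip_add_right ip_sc_left ip_sc_right sc_mem add_mem
        ip_commute[of a b] algebra_simps)
  moreover have "z * cnj z = complex_of_real ((cmod z)\<^sup>2)"
    by (simp add: complex_norm_square[symmetric])
  ultimately show ?thesis by simp
qed

theorem cauchy_schwarz:
  assumes a: "a \<in> E" and b: "b \<in> E"
  shows "(cmod (ip a b))\<^sup>2 \<le> Re (ip a a) * Re (ip b b)"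
proof -
  define w where "w = ip a b"
  have quad: "0 \<le> Re (ip a a) - 2 * s * (cmod w)\<^sup>2 + s\<^sup>2 * (cmod w)\<^sup>2 * Re (ip b b)" for s :: real
  proof -
    \<comment> \<open>moving \<open>a\<close> against the direction of \<open>w\<close> turns the cross term into \<open>- 2 * s * \<bar>w\<bar>^2\<close>\<close>
    define z where "z = - complex_of_real s * w"
    have "Re (cnj z * w) = - s * (cmod w)\<^sup>2"
      unfolding z_def cmod_power2 by (simp add: power2_eq_square algebra_simps)
    moreover have "(cmod z)\<^sup>2 = s\<^sup>2 * (cmod w)\<^sup>2"
      by (simp add: z_def norm_mult power_mult_distrib)
    moreover have "0 \<le> Re (ip (a + sc z b) (a + sc z b))"
      by (intro ip_nonneg add_mem sc_mem a b)
    ultimately show ?thesis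
      unfolding Re_ip_add_sc[OF a b] w_def[symmetric] by (simp add: algebra_simps)
  qed
  show ?thesis
  proof (cases "Re (ip b b) = 0")
    case True
    \<comment> \<open>with no quadratic term, a large \<open>s\<close> would make the right-hand side of \<open>quad\<close> negative\<close>
    have "(cmod w)\<^sup>2 = 0"
    proof (rule ccontr)
      assume "(cmod w)\<^sup>2 \<noteq> 0"
      then have "Re (ip a a) - 2 * ((Re (ip a a) + 1) / (2 * (cmod w)\<^sup>2)) * (cmod w)\<^sup>2 = - 1"
        by (simp add: field_simps)
      then show False
        using quad[of "(Re (ip a a) + 1) / (2 * (cmod w)\<^sup>2)"] True by simp
    qed
    then show ?thesis using True by (simp add: w_def)
  next
    case False
    \<comment> \<open>the minimiser of the quadratic polynomial in \<open>s\<close> is \<open>1 / Re (ip b b)\<close>\<close>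
    then have pos: "0 < Re (ip b b)" using ip_nonneg[OF b] by simp
    then show ?thesis
      using quad[of "1 / Re (ip b b)"]
      by (simp add: w_def[symmetric] power2_eq_square field_simps)
  qed
qed

lemma form_norm_sq: "a \<in> E \<Longrightarrow> (form_norm ip a)\<^sup>2 = Re (ip a a)"
  by (simp add: form_norm_def ip_nonneg)

lemma form_norm_nonneg: "a \<in> E \<Longrightarrow> 0 \<le> form_norm ip a"
  by (simp add: form_norm_def ip_nonneg)

lemma cmod_ip_le:
  assumes "a \<in> E" "b \<in> E"
  shows "cmod (ip a b) \<le> form_norm ip a * form_norm ip b"
proof (rule power2_le_imp_le)
  show "(cmod (ip a b))\<^sup>2 \<le> (form_norm ip a * form_norm ip b)\<^sup>2"
    using cauchy_schwarz[OF assms] assms by (simp add: power_mult_distrib form_norm_sq)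
qed (use assms form_norm_nonneg in simp)

lemma form_norm_triangle:
  assumes "a \<in> E" "b \<in> E"
  shows "form_norm ip (a + b) \<le> form_norm ip a + form_norm ip b"
proof (rule power2_le_imp_le)
  have "Re (ip (a + b) (a + b)) = Re (ip a a) + 2 * Re (ip a b) + Re (ip b b)"
    using assms by (simp add: ip_add_left ip_add_right add_mem ip_commute[of a b])
  moreover have "Re (ip a b) \<le> form_norm ip a * form_norm ip b"
    using cmod_ip_le[OF assms] complex_Re_le_cmod[of "ip a b"] by linarith
  ultimately show "(form_norm ip (a + b))\<^sup>2 \<le> (form_norm ip a + form_norm ip b)\<^sup>2"
    using assms by (simp add: form_norm_sq add_mem power2_sum)
qed (use assms form_norm_nonneg in simp)

lemma form_norm_diff_triangle:
  assumes "a \<in> E" "b \<in> E" "c \<in> E"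
  shows "form_norm ip (a - c) \<le> form_norm ip (a - b) + form_norm ip (b - c)"
  using form_norm_triangle[of "a - b" "b - c"] assms by (simp add: diff_mem)

lemma form_norm_minus: "a \<in> E \<Longrightarrow> form_norm ip (- a) = form_norm ip a"
  using ip_diff_left[of 0 a "- a"] ip_diff_right[of 0 a a]
  by (simp add: form_norm_def zero_mem minus_mem ip_zero_left ip_zero_right)

lemma form_norm_diff_commute:
  "a \<in> E \<Longrightarrow> b \<in> E \<Longrightarrow> form_norm ip (a - b) = form_norm ip (b - a)"
  using form_norm_minus[of "a - b"] by (simp add: diff_mem)

lemma form_norm_zero: "form_norm ip 0 = 0"
  by (simp add: form_norm_def ip_zero_left zero_mem)

section \<open>Cauchy sequences and the completion\<close>

lemma form_cauchyD: "s \<in> form_cauchy E ip \<Longrightarrow> s k \<in> E"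
  by (simp add: form_cauchy_def)

lemma form_cauchy_const: "a \<in> E \<Longrightarrow> (\<lambda>_. a) \<in> form_cauchy E ip"
  by (simp add: form_cauchy_def form_norm_zero)

lemma form_cauchy_diff:
  assumes s: "s \<in> form_cauchy E ip" and t: "t \<in> form_cauchy E ip"
  shows "(\<lambda>k. s k - t k) \<in> form_cauchy E ip"
proof -
  have "\<exists>N. \<forall>k\<ge>N. \<forall>l\<ge>N. form_norm ip ((s k - t k) - (s l - t l)) < e" if "0 < e" for e
  proof -
    obtain N1 where N1: "\<forall>k\<ge>N1. \<forall>l\<ge>N1. form_norm ip (s k - s l) < e / 2"
      using s half_gt_zero[OF \<open>0 < e\<close>] unfolding form_cauchy_def by blast
    obtain N2 where N2: "\<forall>k\<ge>N2. \<forall>l\<ge>N2. form_norm ip (t k - t l) < e / 2"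
      using t half_gt_zero[OF \<open>0 < e\<close>] unfolding form_cauchy_def by blast
    have "form_norm ip ((s k - t k) - (s l - t l)) < e" if "k \<ge> max N1 N2" "l \<ge> max N1 N2" for k l
    proof -
      have "form_norm ip ((s k - s l) + (t l - t k))
          \<le> form_norm ip (s k - s l) + form_norm ip (t l - t k)"
        using s t by (intro form_norm_triangle diff_mem form_cauchyD)
      moreover have "(s k - s l) + (t l - t k) = (s k - t k) - (s l - t l)" by simp
      ultimately have "form_norm ip ((s k - t k) - (s l - t l))
          \<le> form_norm ip (s k - s l) + form_norm ip (t l - t k)" by metis
      moreover have "form_norm ip (s k - s l) < e / 2" "form_norm ip (t l - t k) < e / 2"
        using N1 N2 that by auto
      ultimately show ?thesis by linarith
    qed
    then show ?thesis by blast
  qed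
  then show ?thesis using s t by (auto simp: form_cauchy_def diff_mem)
qed

lemma equiv_form_rel: "equiv (form_cauchy E ip) (form_rel E ip)"
proof (rule equivI)
  show "refl_on (form_cauchy E ip) (form_rel E ip)"
    by (auto simp: refl_on_def form_rel_def form_norm_zero)
  show "form_rel E ip \<subseteq> form_cauchy E ip \<times> form_cauchy E ip"
    by (auto simp: form_rel_def)
  show "sym (form_rel E ip)"
  proof (rule symI)
    fix s t assume "(s, t) \<in> form_rel E ip"
    then show "(t, s) \<in> form_rel E ip"
      using form_norm_diff_commute[OF form_cauchyD form_cauchyD, of s t]
      by (simp add: form_rel_def)
  qed
  show "trans (form_rel E ip)"
  proof (rule transI)
    fix s t u assume st: "(s, t) \<in> form_rel E ip" and tu: "(t, u) \<in> form_rel E ip"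
    have mem: "s k \<in> E" "t k \<in> E" "u k \<in> E" for k
      using st tu by (auto simp: form_rel_def form_cauchyD)
    have "(\<lambda>k. form_norm ip (s k - t k) + form_norm ip (t k - u k)) \<longlonglongrightarrow> 0"
      using st tu by (auto simp: form_rel_def intro: tendsto_add_zero)
    then have "(\<lambda>k. form_norm ip (s k - u k)) \<longlonglongrightarrow> 0"
      by (rule tendsto_sandwich[OF _ _ tendsto_const, rotated 2])
        (auto intro!: always_eventually form_norm_nonneg diff_mem form_norm_diff_triangle mem)
    then show "(s, u) \<in> form_rel E ip" using st tu by (simp add: form_rel_def)
  qed
qed

lemma form_norm_reverse_triangle:
  assumes "a \<in> E" "b \<in> E"
  shows "\<bar>form_norm ip a - form_norm ip b\<bar> \<le> form_norm ip (a - b)"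
  using form_norm_triangle[of "a - b" b] form_norm_triangle[of "b - a" a]
    form_norm_diff_commute[of a b] assms by (simp add: diff_mem)

lemma form_cauchy_norm_bounded:
  assumes s: "s \<in> form_cauchy E ip"
  obtains B where "0 < B" "\<And>k. form_norm ip (s k) \<le> B"
proof -
  have "Cauchy (\<lambda>k. form_norm ip (s k))"
  proof (rule metric_CauchyI)
    fix e :: real assume "0 < e"
    then obtain N where "\<forall>k\<ge>N. \<forall>l\<ge>N. form_norm ip (s k - s l) < e"
      using s unfolding form_cauchy_def by blast
    then show "\<exists>N. \<forall>k\<ge>N. \<forall>l\<ge>N. dist (form_norm ip (s k)) (form_norm ip (s l)) < e"
      using form_norm_reverse_triangle[OF form_cauchyD[OF s] form_cauchyD[OF s]]
      unfolding dist_real_def by (meson le_less_trans)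
  qed
  then have "Bseq (\<lambda>k. form_norm ip (s k))"
    by (simp add: Cauchy_convergent convergent_imp_Bseq real_Cauchy_convergent)
  then obtain B where "0 < B" "\<And>k. norm (form_norm ip (s k)) \<le> B" by (auto elim: BseqE)
  then show thesis by (intro that[of B]) (auto simp: abs_le_iff)
qed

lemma ip_diff_bound:
  assumes "a \<in> E" "b \<in> E" "a' \<in> E" "b' \<in> E"
  shows "cmod (ip a b - ip a' b')
    \<le> form_norm ip (a - a') * form_norm ip b + form_norm ip a' * form_norm ip (b - b')"
proof -
  have "ip a b - ip a' b' = ip (a - a') b + ip a' (b - b')"
    using assms by (simp add: ip_diff_left ip_diff_right)
  then show ?thesis
    using norm_triangle_ineq[of "ip (a - a') b" "ip a' (b - b')"]
      cmod_ip_le[OF diff_mem[OF assms(1,3)] assms(2)] cmod_ip_le[OF assms(3) diff_mem[OF assms(2,4)]]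
    by simp
qed

lemma ip_convergent:
  assumes s: "s \<in> form_cauchy E ip" and t: "t \<in> form_cauchy E ip"
  shows "convergent (\<lambda>k. ip (s k) (t k))"
proof -
  obtain B where B: "0 < B" "\<And>k. form_norm ip (s k) \<le> B"
    using form_cauchy_norm_bounded[OF s] by blast
  obtain C where C: "0 < C" "\<And>k. form_norm ip (t k) \<le> C"
    using form_cauchy_norm_bounded[OF t] by blast
  have "Cauchy (\<lambda>k. ip (s k) (t k))"
  proof (rule metric_CauchyI)
    fix e :: real assume e: "0 < e"
    have "0 < e / (2 * C)" "0 < e / (2 * B)" using e B C by simp_all
    then obtain N1 N2 where N1: "\<forall>k\<ge>N1. \<forall>l\<ge>N1. form_norm ip (s k - s l) < e / (2 * C)"
      and N2: "\<forall>k\<ge>N2. \<forall>l\<ge>N2. form_norm ip (t k - t l) < e / (2 * B)"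
      using s t unfolding form_cauchy_def by blast
    have "dist (ip (s k) (t k)) (ip (s l) (t l)) < e" if "k \<ge> max N1 N2" "l \<ge> max N1 N2" for k l
    proof -
      have "form_norm ip (s k - s l) * form_norm ip (t k) \<le> form_norm ip (s k - s l) * C"
        using C s by (intro mult_left_mono form_norm_nonneg diff_mem form_cauchyD) auto
      moreover have "form_norm ip (s k - s l) * C < e / (2 * C) * C"
        using C N1 that by (intro mult_strict_right_mono) auto
      moreover have "form_norm ip (s l) * form_norm ip (t k - t l)
          \<le> B * form_norm ip (t k - t l)"
        using B t by (intro mult_right_mono form_norm_nonneg diff_mem form_cauchyD) auto
      moreover have "B * form_norm ip (t k - t l) < B * (e / (2 * B))"
        using B N2 that by (intro mult_strict_left_mono) auto
      ultimately show ?thesis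
        using ip_diff_bound[of "s k" "t k" "s l" "t l"] B C
        by (simp add: dist_norm form_cauchyD[OF s] form_cauchyD[OF t])
    qed
    then show "\<exists>N. \<forall>k\<ge>N. \<forall>l\<ge>N. dist (ip (s k) (t k)) (ip (s l) (t l)) < e" by blast
  qed
  then show ?thesis by (simp add: Cauchy_convergent_iff)
qed

lemma ip_tendsto_cong:
  assumes ss: "(s, s') \<in> form_rel E ip" and tt: "(t, t') \<in> form_rel E ip"
    and lim: "(\<lambda>k. ip (s k) (t k)) \<longlonglongrightarrow> l"
  shows "(\<lambda>k. ip (s' k) (t' k)) \<longlonglongrightarrow> l"
proof -
  have c: "s \<in> form_cauchy E ip" "s' \<in> form_cauchy E ip" "t \<in> form_cauchy E ip"
    "t' \<in> form_cauchy E ip"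
    and s0: "(\<lambda>k. form_norm ip (s k - s' k)) \<longlonglongrightarrow> 0"
    and t0: "(\<lambda>k. form_norm ip (t k - t' k)) \<longlonglongrightarrow> 0"
    using ss tt by (auto simp: form_rel_def)
  obtain B where B: "0 < B" "\<And>k. form_norm ip (s' k) \<le> B"
    using form_cauchy_norm_bounded[OF c(2)] by blast
  obtain C where C: "0 < C" "\<And>k. form_norm ip (t k) \<le> C"
    using form_cauchy_norm_bounded[OF c(3)] by blast
  have le: "cmod (ip (s k) (t k) - ip (s' k) (t' k))
      \<le> form_norm ip (s k - s' k) * C + B * form_norm ip (t k - t' k)" for k
  proof -
    have "form_norm ip (s k - s' k) * form_norm ip (t k) \<le> form_norm ip (s k - s' k) * C"
      using C c by (intro mult_left_mono form_norm_nonneg diff_mem form_cauchyD) auto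
    moreover have "form_norm ip (s' k) * form_norm ip (t k - t' k)
        \<le> B * form_norm ip (t k - t' k)"
      using B c by (intro mult_right_mono form_norm_nonneg diff_mem form_cauchyD) auto
    ultimately show ?thesis
      using ip_diff_bound[of "s k" "t k" "s' k" "t' k"] by (simp add: c form_cauchyD)
  qed
  have "(\<lambda>k. form_norm ip (s k - s' k) * C + B * form_norm ip (t k - t' k)) \<longlonglongrightarrow> 0"
    using tendsto_add[OF tendsto_mult_right[OF s0, of C] tendsto_mult_left[OF t0, of B]] by simp
  then have "(\<lambda>k. ip (s k) (t k) - ip (s' k) (t' k)) \<longlonglongrightarrow> 0"
    by (rule Lim_null_comparison[OF always_eventually[OF allI[OF le]]])
  from tendsto_diff[OF lim this] show ?thesis by simp
qed

text \<open>
  Points of the completion can be paired through any chosen representatives: equivalent Cauchy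
  sequences differ by a null sequence, and the other factor stays bounded.
\<close>

lemma completion_inner_eq:
  assumes s: "s \<in> form_cauchy E ip" and t: "t \<in> form_cauchy E ip"
    and lim: "(\<lambda>k. ip (s k) (t k)) \<longlonglongrightarrow> l"
  shows "completion_inner ip (form_rel E ip `` {s}) (form_rel E ip `` {t}) = l"
  unfolding completion_inner_def
proof (rule the_equality)
  show "\<forall>s'\<in>form_rel E ip `` {s}. \<forall>t'\<in>form_rel E ip `` {t}. (\<lambda>k. ip (s' k) (t' k)) \<longlonglongrightarrow> l"
    using ip_tendsto_cong[OF _ _ lim] by blast
next
  fix l' assume "\<forall>s'\<in>form_rel E ip `` {s}. \<forall>t'\<in>form_rel E ip `` {t}. (\<lambda>k. ip (s' k) (t' k)) \<longlonglongrightarrow> l'"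
  then have "(\<lambda>k. ip (s k) (t k)) \<longlonglongrightarrow> l'"
    using equiv_class_self[OF equiv_form_rel] s t by blast
  then show "l' = l" using LIMSEQ_unique lim by blast
qed

lemma completion_diff_eq:
  assumes s: "s \<in> form_cauchy E ip" and t: "t \<in> form_cauchy E ip"
  shows "completion_diff E ip (form_rel E ip `` {s}) (form_rel E ip `` {t}) =
    form_rel E ip `` {\<lambda>k. s k - t k}"
proof -
  have cong: "form_rel E ip `` {\<lambda>k. s' k - t' k} = form_rel E ip `` {\<lambda>k. s k - t k}"
    if "s' \<in> form_rel E ip `` {s}" "t' \<in> form_rel E ip `` {t}" for s' t'
  proof (rule equiv_class_eq[OF equiv_form_rel, symmetric])
    have c: "s' \<in> form_cauchy E ip" "t' \<in> form_cauchy E ip"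
      and s0: "(\<lambda>k. form_norm ip (s k - s' k)) \<longlonglongrightarrow> 0"
      and t0: "(\<lambda>k. form_norm ip (t k - t' k)) \<longlonglongrightarrow> 0"
      using that by (auto simp: form_rel_def)
    have mem: "s k \<in> E" "s' k \<in> E" "t k \<in> E" "t' k \<in> E" for k
      using s t c form_cauchyD by blast+
    have le: "form_norm ip ((s k - t k) - (s' k - t' k))
        \<le> form_norm ip (s k - s' k) + form_norm ip (t k - t' k)" for k
    proof -
      have "form_norm ip ((s k - s' k) + (t' k - t k))
          \<le> form_norm ip (s k - s' k) + form_norm ip (t' k - t k)"
        by (intro form_norm_triangle diff_mem mem)
      moreover have "(s k - s' k) + (t' k - t k) = (s k - t k) - (s' k - t' k)" by simp
      ultimately show ?thesis by (metis form_norm_diff_commute mem(3,4))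
    qed
    have nonneg: "0 \<le> form_norm ip ((s k - t k) - (s' k - t' k))" for k
      by (intro form_norm_nonneg diff_mem mem)
    have "(\<lambda>k. form_norm ip ((s k - t k) - (s' k - t' k))) \<longlonglongrightarrow> 0"
      using tendsto_add_zero[OF s0 t0]
      by (rule tendsto_sandwich[OF always_eventually[OF allI[OF nonneg]]
            always_eventually[OF allI[OF le]] tendsto_const])
    then show "(\<lambda>k. s k - t k, \<lambda>k. s' k - t' k) \<in> form_rel E ip"
      using s t c by (simp add: form_rel_def form_cauchy_diff)
  qed
  have "s \<in> form_rel E ip `` {s}" "t \<in> form_rel E ip `` {t}"
    using equiv_class_self[OF equiv_form_rel] s t by blast+
  then show ?thesis unfolding completion_diff_def using cong by blast
qed

text \<open>
  The square root of a negative real is negative here, so this needs the inner product of a point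
  with itself to be a limit of squared lengths.
\<close>

lemma completion_norm_nonneg:
  assumes "s \<in> form_cauchy E ip"
  shows "0 \<le> completion_norm ip (form_rel E ip `` {s})"
proof -
  obtain l where l: "(\<lambda>k. ip (s k) (s k)) \<longlonglongrightarrow> l"
    using ip_convergent[OF assms assms] by (auto simp: convergent_def)
  have "0 \<le> Re l"
    by (rule LIMSEQ_le_const[OF tendsto_Re[OF l]]) (auto intro!: ip_nonneg form_cauchyD assms)
  then show ?thesis
    by (simp add: completion_norm_def completion_inner_eq[OF assms assms l])
qed

section \<open>Riesz representation\<close>

text \<open>
  The Riesz representation theorem for a bounded conjugate-linear functional \<open>f\<close>, stated with a Cauchy
  sequence in place of its limit in the completion.  The functional \<open>\<Phi> a = \<langle>a, a\<rangle> - 2 Re (f a)\<close> is bounded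
  below by \<open>- K\<close>; if \<open>f = \<langle>v, -\<rangle>\<close>, it equals the squared distance from \<open>a\<close> to \<open>v\<close> up to a constant.  The
  parallelogram law makes a minimising sequence Cauchy, and comparing it with its translates by
  multiples of \<open>q\<close> shows that the defect \<open>\<langle>p k, q\<rangle> - f q\<close> vanishes in the limit.  Taking \<open>q = p k\<close> gives
  \<open>f (p k) \<longlonglongrightarrow> L\<close>, whence \<open>L\<^sup>2 \<le> K * L\<close>.
\<close>

theorem riesz_sequence:
  assumes f_add: "\<And>a b. a \<in> E \<Longrightarrow> b \<in> E \<Longrightarrow> f (a + b) = f a + f b"
    and f_sc: "\<And>z a. a \<in> E \<Longrightarrow> f (sc z a) = cnj z * f a"
    and bound: "\<And>a. a \<in> E \<Longrightarrow> (cmod (f a))\<^sup>2 \<le> K * Re (ip a a)" and K: "0 \<le> K"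
  obtains p L where "p \<in> form_cauchy E ip" "\<And>q. q \<in> E \<Longrightarrow> (\<lambda>k. ip (p k) q) \<longlonglongrightarrow> f q"
    "(\<lambda>k. ip (p k) (p k)) \<longlonglongrightarrow> complex_of_real L" "L \<le> K"
proof -
  define \<Phi> where "\<Phi> a = Re (ip a a) - 2 * Re (f a)" for a
  have lower: "- K \<le> \<Phi> a" if "a \<in> E" for a
  proof -
    \<comment> \<open>\<open>2 * \<bar>f a\<bar>\<close> is at most \<open>2 * sqrt (K * N)\<close>, hence at most \<open>K + N\<close>\<close>
    let ?N = "Re (ip a a)"
    have "(2 * cmod (f a))\<^sup>2 \<le> 4 * (K * ?N)"
      using bound[OF that] by (simp add: power_mult_distrib)
    also have "\<dots> \<le> (K + ?N)\<^sup>2"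
      using zero_le_power2[of "K - ?N"] by (simp add: power2_diff power2_sum)
    finally have "2 * cmod (f a) \<le> K + ?N"
      by (rule power2_le_imp_le) (use K ip_nonneg[OF that] in simp)
    then show ?thesis using complex_Re_le_cmod[of "f a"] by (simp add: \<Phi>_def)
  qed
  define m where "m = Inf (\<Phi> ` E)"
  have bdd: "bdd_below (\<Phi> ` E)" using lower by (auto intro!: bdd_belowI)
  have m_le: "m \<le> \<Phi> a" if "a \<in> E" for a
    unfolding m_def using bdd that by (simp add: cInf_lower)
  have "\<exists>a\<in>E. \<Phi> a < m + 1 / real (Suc k)" for k
  proof -
    have "Inf (\<Phi> ` E) < m + 1 / real (Suc k)" by (simp add: m_def)
    then show ?thesis using zero_mem by (subst (asm) cInf_less_iff) (auto simp: bdd)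
  qed
  then obtain p where pE: "\<And>k. p k \<in> E" and p: "\<And>k. \<Phi> (p k) < m + 1 / real (Suc k)"
    by metis
  have para: "(form_norm ip (a - b))\<^sup>2 \<le> 2 * \<Phi> a + 2 * \<Phi> b - 4 * m" if "a \<in> E" "b \<in> E" for a b
  proof -
    have "m \<le> \<Phi> (sc (1/2) (a + b))" using that by (intro m_le sc_mem add_mem)
    moreover have "Re (ip (a - b) (a - b)) = 2 * \<Phi> a + 2 * \<Phi> b - 4 * \<Phi> (sc (1/2) (a + b))"
      using that by (simp add: \<Phi>_def ip_sc_left ip_sc_right f_sc f_add add_mem sc_mem diff_mem
          ip_add_left ip_add_right ip_diff_left ip_diff_right field_simps)
    ultimately show ?thesis using that by (simp add: form_norm_sq diff_mem)
  qed
  have pC: "p \<in> form_cauchy E ip"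
    unfolding form_cauchy_def
  proof (intro CollectI conjI allI impI pE)
    fix e :: real assume e: "0 < e"
    then obtain N where N: "4 / e\<^sup>2 < real N" using reals_Archimedean2 by blast
    have "form_norm ip (p k - p l) < e" if "k \<ge> N" "l \<ge> N" for k l
    proof (rule power2_less_imp_less)
      have "0 < real N" using N e by (smt (verit) divide_pos_pos zero_less_power)
      have "1 / real (Suc k) \<le> 1 / real N" "1 / real (Suc l) \<le> 1 / real N"
        using that \<open>0 < real N\<close> by (auto intro!: divide_left_mono)
      then have "(form_norm ip (p k - p l))\<^sup>2 < 4 * (1 / real N)"
        using para[OF pE pE, of k l] p[of k] p[of l] by linarith
      also have "\<dots> < e\<^sup>2" using N e \<open>0 < real N\<close> by (simp add: field_simps)
      finally show "(form_norm ip (p k - p l))\<^sup>2 < e\<^sup>2" .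
    qed (use e in simp)
    then show "\<exists>N. \<forall>k\<ge>N. \<forall>l\<ge>N. form_norm ip (p k - p l) < e" by blast
  qed
  have gap: "(cmod (ip (p k) q - f q))\<^sup>2 \<le> (Re (ip q q) + 1) * (1 / real (Suc k))"
    if q: "q \<in> E" for k q
  proof -
    define w where "w = ip (p k) q - f q"
    define N where "N = Re (ip q q)"
    \<comment> \<open>dividing by \<open>N + 1\<close> instead of \<open>N\<close> covers vectors \<open>q\<close> of length zero as well\<close>
    define s where "s = 1 / (N + 1)"
    have N0: "0 \<le> N" unfolding N_def by (rule ip_nonneg[OF q])
    define z where "z = - complex_of_real s * w"
    have czw: "Re (cnj z * w) = - s * (cmod w)\<^sup>2"
      unfolding z_def cmod_power2 by (simp add: power2_eq_square algebra_simps)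
    have "\<Phi> (p k + sc z q) = \<Phi> (p k) + 2 * Re (cnj z * w) + (cmod z)\<^sup>2 * N"
      unfolding \<Phi>_def Re_ip_add_sc[OF pE q] f_add[OF pE sc_mem[OF q]] f_sc[OF q]
      by (simp add: w_def N_def algebra_simps)
    moreover have "(cmod z)\<^sup>2 = s\<^sup>2 * (cmod w)\<^sup>2"
      by (simp add: z_def norm_mult power_mult_distrib)
    moreover have "m \<le> \<Phi> (p k + sc z q)" by (intro m_le add_mem sc_mem pE q)
    ultimately have 1: "2 * s * (cmod w)\<^sup>2 - s * (s * N) * (cmod w)\<^sup>2 \<le> 1 / real (Suc k)"
      using p[of k] czw by (simp add: power2_eq_square algebra_simps)
    have "s * N \<le> 1" "0 < s" using N0 by (auto simp: s_def)
    then have "s * (s * N) * (cmod w)\<^sup>2 \<le> s * 1 * (cmod w)\<^sup>2"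
      by (intro mult_right_mono mult_left_mono) auto
    with 1 have "s * (cmod w)\<^sup>2 \<le> 1 / real (Suc k)" by simp
    then have "(N + 1) * (s * (cmod w)\<^sup>2) \<le> (N + 1) * (1 / real (Suc k))"
      using N0 by (intro mult_left_mono) auto
    then show ?thesis using N0 by (simp add: s_def w_def[symmetric] N_def[symmetric])
  qed
  have inv0: "(\<lambda>k. c * (1 / real (Suc k))) \<longlonglongrightarrow> 0" for c :: real
    using tendsto_mult_left[OF LIMSEQ_inverse_real_of_nat, of c] by (simp add: field_simps)
  have null: "w \<longlonglongrightarrow> 0" if "\<And>k. (cmod (w k))\<^sup>2 \<le> c * (1 / real (Suc k))" for w c
  proof -
    have "(\<lambda>k. (cmod (w k))\<^sup>2) \<longlonglongrightarrow> 0"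
      by (rule tendsto_sandwich[OF always_eventually[OF allI[OF zero_le_power2]]
            always_eventually[OF allI[OF that]] tendsto_const inv0])
    from tendsto_real_sqrt[OF this] show ?thesis by (simp add: tendsto_norm_zero_iff)
  qed
  have rep: "(\<lambda>k. ip (p k) q) \<longlonglongrightarrow> f q" if "q \<in> E" for q
    using null[OF gap[OF that]] by (simp add: LIM_zero_iff)
  obtain l where l: "(\<lambda>k. ip (p k) (p k)) \<longlonglongrightarrow> l"
    using ip_convergent[OF pC pC] by (auto simp: convergent_def)
  have lRe: "(\<lambda>k. Re (ip (p k) (p k))) \<longlonglongrightarrow> Re l" by (rule tendsto_Re[OF l])
  have "(\<lambda>k. ip (p k) (p k)) \<longlonglongrightarrow> complex_of_real (Re l)"
    by (subst ip_self[OF pE]) (rule tendsto_of_real[OF lRe])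
  moreover from this have l_eq: "l = complex_of_real (Re l)" using LIMSEQ_unique l by blast
  moreover have "Re l \<le> K"
  proof -
    have l0: "0 \<le> Re l"
      by (rule LIMSEQ_le_const[OF lRe]) (auto intro!: ip_nonneg pE)
    obtain B where B: "0 < B" "\<And>k. form_norm ip (p k) \<le> B"
      using form_cauchy_norm_bounded[OF pC] by blast
    \<comment> \<open>the estimate \<open>gap\<close> is uniform over bounded \<open>q\<close>, so it may be used with \<open>q = p k\<close>\<close>
    have "(cmod (ip (p k) (p k) - f (p k)))\<^sup>2 \<le> (B\<^sup>2 + 1) * (1 / real (Suc k))" for k
    proof -
      have "Re (ip (p k) (p k)) \<le> B\<^sup>2"
        using B(2)[of k] form_norm_nonneg[OF pE] by (simp add: form_norm_sq[OF pE, symmetric] power_mono)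
      then have "(Re (ip (p k) (p k)) + 1) * (1 / real (Suc k)) \<le> (B\<^sup>2 + 1) * (1 / real (Suc k))"
        by (intro mult_right_mono) auto
      then show ?thesis using gap[OF pE, of k k] by linarith
    qed
    then have "(\<lambda>k. ip (p k) (p k) - f (p k)) \<longlonglongrightarrow> 0" by (rule null)
    from tendsto_diff[OF l this] have "(\<lambda>k. f (p k)) \<longlonglongrightarrow> l" by simp
    then have "(\<lambda>k. (cmod (f (p k)))\<^sup>2) \<longlonglongrightarrow> (cmod l)\<^sup>2"
      by (intro tendsto_power tendsto_norm)
    then have "(cmod l)\<^sup>2 \<le> K * Re l"
      by (rule LIMSEQ_le[OF _ tendsto_mult_left[OF lRe]]) (auto intro!: bound pE)
    moreover have "cmod l = Re l" using l0 by (subst l_eq) simp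
    ultimately have "Re l * Re l \<le> K * Re l" by (simp add: power2_eq_square)
    then show ?thesis using l0 K by (cases "Re l = 0") auto
  qed
  ultimately show thesis using that pC rep by blast
qed

end

text \<open>
  Finite direct sums.  Applied once this gives the form on tuples over \<open>M\<close>, applied twice the form on
  matrices over the tensor product.
\<close>

lemma semi_inner_space_vec:
  assumes "semi_inner_space E sc ip"
  shows "semi_inner_space {A :: 'e::ab_group_add ^ 'n::finite. \<forall>i. A $ i \<in> E}
    (\<lambda>z A. \<chi> i. sc z (A $ i)) (\<lambda>A B. \<Sum>i\<in>UNIV. ip (A $ i) (B $ i))"
proof -
  interpret semi_inner_space E sc ip by (rule assms)
  show ?thesis
    by unfold_locales
      (auto simp: zero_mem add_mem minus_mem sc_mem ip_add_left ip_sc_left sum.distrib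
        sum_distrib_left ip_nonneg intro!: sum_nonneg sum.cong ip_commute)
qed

section \<open>The Schur product theorem\<close>

text \<open>
  Positive semidefinite kernels on a finite index set.  Indexing by a set instead of by numbers lets
  the formal tensors in the support of a combination be the indices.
\<close>

definition psd_on :: "'k set \<Rightarrow> ('k \<Rightarrow> 'k \<Rightarrow> complex) \<Rightarrow> bool" where
  "psd_on K G \<longleftrightarrow>
    (\<forall>k\<in>K. \<forall>l\<in>K. G l k = cnj (G k l)) \<and>
    (\<forall>z. 0 \<le> Re (\<Sum>k\<in>K. \<Sum>l\<in>K. z k * cnj (z l) * G k l))"

lemma psd_onD:
  assumes "psd_on K G"
  shows "k \<in> K \<Longrightarrow> l \<in> K \<Longrightarrow> G l k = cnj (G k l)"
    and "0 \<le> Re (\<Sum>k\<in>K. \<Sum>l\<in>K. z k * cnj (z l) * G k l)"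
  using assms unfolding psd_on_def by blast+

lemma psd_on_subset:
  assumes G: "psd_on K G" and K: "finite K" "L \<subseteq> K"
  shows "psd_on L G"
  unfolding psd_on_def
proof (intro conjI allI ballI)
  fix z :: "'a \<Rightarrow> complex"
  define y where "y k = (if k \<in> L then z k else 0)" for k
  have "(\<Sum>k\<in>K. \<Sum>l\<in>K. y k * cnj (y l) * G k l) = (\<Sum>k\<in>L. \<Sum>l\<in>K. y k * cnj (y l) * G k l)"
    using K by (intro sum.mono_neutral_right) (auto simp: y_def)
  also have "\<dots> = (\<Sum>k\<in>L. \<Sum>l\<in>L. z k * cnj (z l) * G k l)"
    using K by (intro sum.cong refl sum.mono_neutral_cong_right) (auto simp: y_def)
  finally show "0 \<le> Re (\<Sum>k\<in>L. \<Sum>l\<in>L. z k * cnj (z l) * G k l)"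
    using psd_onD(2)[OF G, of y] by simp
qed (use psd_onD(1)[OF G] K in blast)

lemma (in semi_inner_space) gram_psd_on:
  fixes a :: "'k \<Rightarrow> 'e"
  assumes "\<And>k. k \<in> K \<Longrightarrow> a k \<in> E"
  shows "psd_on K (\<lambda>k l. ip (a k) (a l))"
  unfolding psd_on_def
proof (intro conjI allI ballI)
  fix z :: "'k \<Rightarrow> complex"
  have "(\<Sum>k\<in>K. \<Sum>l\<in>K. z k * cnj (z l) * ip (a k) (a l)) =
      ip (\<Sum>k\<in>K. sc (z k) (a k)) (\<Sum>l\<in>K. sc (z l) (a l))"
    using assms
    by (subst sum.swap) (simp add: ip_sum_left ip_sum_right sum_mem sc_mem ip_sc_left ip_sc_right
        sum_distrib_left mult_ac)
  then show "0 \<le> Re (\<Sum>k\<in>K. \<Sum>l\<in>K. z k * cnj (z l) * ip (a k) (a l))"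
    by (simp add: ip_nonneg sum_mem sc_mem assms)
qed (use assms ip_commute in blast)

lemma psd_on_diagonal:
  assumes "psd_on K G" "finite K" "k \<in> K"
  shows "G k k = complex_of_real (Re (G k k))" "0 \<le> Re (G k k)"
proof -
  show "G k k = complex_of_real (Re (G k k))"
    using arg_cong[OF psd_onD(1)[OF assms(1,3,3)], of Im] by (simp add: complex_eq_iff)
  have "psd_on {k} G" by (rule psd_on_subset[OF assms(1,2)]) (use assms(3) in simp)
  from psd_onD(2)[OF this, of "\<lambda>_. 1"] show "0 \<le> Re (G k k)" by simp
qed

text \<open>
  A vanishing diagonal entry forces its row to vanish, since otherwise the quadratic form of the
  \<open>2 \<times> 2\<close> block on \<open>x\<close> and \<open>k\<close> would be affine and unbounded below in the coefficient at \<open>x\<close>.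
\<close>

lemma psd_on_zero_diagonal:
  assumes G: "psd_on K G" and K: "finite K" "x \<in> K" "k \<in> K" and zero: "G x x = 0"
  shows "G x k = 0"
proof (cases "k = x")
  case False
  have 2: "psd_on {x, k} G" by (rule psd_on_subset[OF G K(1)]) (use K in simp)
  define c where "c = Re (G k k)"
  have "0 \<le> c - 2 * t * (cmod (G x k))\<^sup>2" for t :: real
  proof -
    define z where "z = (\<lambda>j. if j = x then - complex_of_real t * cnj (G x k) else 1)"
    have "Re (\<Sum>i\<in>{x, k}. \<Sum>j\<in>{x, k}. z i * cnj (z j) * G i j) = c - 2 * t * (cmod (G x k))\<^sup>2"
      using False zero psd_onD(1)[OF G K(2,3)]
      unfolding cmod_power2 by (simp add: z_def c_def power2_eq_square algebra_simps)
    then show ?thesis using psd_onD(2)[OF 2, of z] by simp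
  qed
  from this[of "(c + 1) / (2 * (cmod (G x k))\<^sup>2)"] show ?thesis
    by (cases "G x k = 0") (auto simp: field_simps)
qed (use zero in simp)

text \<open>
  One step of Cholesky elimination.  Subtracting the rank one kernel \<open>G k x * G x l / G x x\<close> leaves the
  Schur complement \<open>G'\<close>, which is positive semidefinite and vanishes in the row and column of \<open>x\<close>, so
  the induction hypothesis applies to \<open>G'\<close> and \<open>H\<close> on the remaining indices.  The product of the rank
  one kernel with \<open>H\<close> is a rescaled congruent copy of \<open>H\<close>.
\<close>

theorem schur_product:
  assumes "finite K" "psd_on K G" "psd_on K H"
  shows "psd_on K (\<lambda>k l. G k l * H k l)"
  using assms
proof (induction K arbitrary: G rule: finite_induct)
  case empty
  then show ?case by (simp add: psd_on_def)
next
  case (insert x K G)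
  let ?I = "insert x K"
  have fin: "finite ?I" using insert by simp
  note G = \<open>psd_on ?I G\<close> and H = \<open>psd_on ?I H\<close>
  have herm: "G l k = cnj (G k l)" if "k \<in> ?I" "l \<in> ?I" for k l
    by (rule psd_onD(1)[OF G that])
  define g where "g = Re (G x x)"
  have gxx: "G x x = complex_of_real g" and g0: "0 \<le> g"
    unfolding g_def using psd_on_diagonal[OF G fin, of x] by auto
  \<comment> \<open>if \<open>g = 0\<close>, the division makes the correction vanish, as it should: the row of \<open>x\<close> is zero already\<close>
  define G' where "G' k l = G k l - G k x * G x l / complex_of_real g" for k l
  have G'x: "G' x l = 0" "G' l x = 0" if "l \<in> ?I" for l
  proof -
    have "G x l = 0" if "g = 0"
      using psd_on_zero_diagonal[OF G fin, of x l] \<open>l \<in> ?I\<close> gxx that by simp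
    then show "G' x l = 0" by (cases "g = 0") (auto simp: G'_def gxx)
    have "G l x = cnj (G x l)" using herm that by blast
    then show "G' l x = 0"
      using \<open>g = 0 \<Longrightarrow> G x l = 0\<close> by (cases "g = 0") (auto simp: G'_def gxx)
  qed
  have "psd_on K G'"
    unfolding psd_on_def
  proof (intro conjI allI ballI)
    fix k l assume "k \<in> K" "l \<in> K"
    then show "G' l k = cnj (G' k l)"
      using herm[of k l] herm[of k x] herm[of x l] by (simp add: G'_def mult.commute)
  next
    fix z :: "'a \<Rightarrow> complex"
    define s where "s = (\<Sum>k\<in>K. z k * G k x)"
    \<comment> \<open>this coefficient at \<open>x\<close> minimises the form of \<open>G\<close>, and the minimum is that of the Schur complement\<close>
    define y where "y = z(x := - s / complex_of_real g)"
    have GxK: "G x l = cnj (G l x)" if "l \<in> K" for l using herm[of l x] that by blast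
    have cs: "(\<Sum>l\<in>K. cnj (z l) * G x l) = cnj s"
      unfolding s_def cnj_sum by (intro sum.cong refl) (simp add: GxK)
    have yK: "y k = z k" if "k \<in> K" for k using that insert.hyps by (auto simp: y_def)
    have yx: "y x = - s / complex_of_real g" by (simp add: y_def)
    have "(\<Sum>k\<in>?I. \<Sum>l\<in>?I. y k * cnj (y l) * G k l) =
        y x * cnj (y x) * G x x + y x * (\<Sum>l\<in>K. cnj (z l) * G x l)
        + cnj (y x) * s + (\<Sum>k\<in>K. \<Sum>l\<in>K. z k * cnj (z l) * G k l)"
      using insert.hyps by (simp add: yK s_def sum.distrib sum_distrib_left algebra_simps)
    also have "\<dots> = (\<Sum>k\<in>K. \<Sum>l\<in>K. z k * cnj (z l) * G k l) - s * cnj s / complex_of_real g"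
      unfolding cs gxx yx by (cases "g = 0") (auto simp: field_simps)
    also have "s * cnj s / complex_of_real g =
        (\<Sum>k\<in>K. \<Sum>l\<in>K. z k * cnj (z l) * (G k x * G x l / complex_of_real g))"
      by (simp add: cs[symmetric]) (simp add: s_def sum_product sum_divide_distrib algebra_simps)
    also have "(\<Sum>k\<in>K. \<Sum>l\<in>K. z k * cnj (z l) * G k l) - \<dots> =
        (\<Sum>k\<in>K. \<Sum>l\<in>K. z k * cnj (z l) * G' k l)"
      by (simp add: G'_def sum_subtractf right_diff_distrib)
    finally show "0 \<le> Re (\<Sum>k\<in>K. \<Sum>l\<in>K. z k * cnj (z l) * G' k l)"
      using psd_onD(2)[OF G, of y] by simp
  qed
  moreover have "psd_on K H" by (rule psd_on_subset[OF H fin]) auto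
  ultimately have IH: "psd_on K (\<lambda>k l. G' k l * H k l)" by (rule insert.IH)
  show ?case
    unfolding psd_on_def
  proof (intro conjI allI ballI)
    fix k l assume "k \<in> ?I" "l \<in> ?I"
    then show "G l k * H l k = cnj (G k l * H k l)"
      using herm[of k l] psd_onD(1)[OF H, of k l] by simp
  next
    fix z :: "'a \<Rightarrow> complex"
    define y where "y k = z k * G k x" for k
    have yc: "cnj (y l) = cnj (z l) * G x l" if "l \<in> ?I" for l
      using herm[of l x] that by (simp add: y_def)
    have split: "z k * cnj (z l) * (G k l * H k l) = z k * cnj (z l) * (G' k l * H k l)
        + y k * cnj (y l) * H k l / complex_of_real g" if "k \<in> ?I" "l \<in> ?I" for k l
      using that by (simp add: G'_def yc) (simp add: y_def algebra_simps)
    have "(\<Sum>k\<in>?I. \<Sum>l\<in>?I. z k * cnj (z l) * (G k l * H k l)) =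
        (\<Sum>k\<in>?I. \<Sum>l\<in>?I. z k * cnj (z l) * (G' k l * H k l)
          + y k * cnj (y l) * H k l / complex_of_real g)"
      by (intro sum.cong refl split)
    also have "\<dots> = (\<Sum>k\<in>?I. \<Sum>l\<in>?I. z k * cnj (z l) * (G' k l * H k l))
        + (\<Sum>k\<in>?I. \<Sum>l\<in>?I. y k * cnj (y l) * H k l) / complex_of_real g"
      by (simp add: sum.distrib sum_divide_distrib del: sum.insert)
    also have "(\<Sum>k\<in>?I. \<Sum>l\<in>?I. z k * cnj (z l) * (G' k l * H k l)) =
        (\<Sum>k\<in>K. \<Sum>l\<in>K. z k * cnj (z l) * (G' k l * H k l))"
      using insert.hyps G'x by (simp add: sum.neutral)
    finally show "0 \<le> Re (\<Sum>k\<in>?I. \<Sum>l\<in>?I. z k * cnj (z l) * (G k l * H k l))"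
      using psd_onD(2)[OF IH, of z] psd_onD(2)[OF H, of y] g0
      by (simp add: Re_divide_of_real del: sum.insert Re_sum)
  qed
qed

section \<open>Positivity of the form on tensors\<close>

lemma tensor_state_superset:
  assumes "finite K" "Poly_Mapping.keys s \<subseteq> K"
  shows "tensor_state \<phi> s = (\<Sum>k\<in>K. Poly_Mapping.lookup s k * (\<phi> (fst k) * \<phi> (snd k)))"
  unfolding tensor_state_def case_prod_unfold prod.collapse mult.assoc
  by (rule sum.mono_neutral_left) (use assms in \<open>auto simp: in_keys_iff\<close>)

lemma tensor_state_add: "tensor_state \<phi> (s + t) = tensor_state \<phi> s + tensor_state \<phi> t"
proof -
  let ?K = "Poly_Mapping.keys s \<union> Poly_Mapping.keys t"
  have "finite ?K" "Poly_Mapping.keys (s + t) \<subseteq> ?K" by (auto simp: keys_add)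
  then show ?thesis
    by (simp add: tensor_state_superset[of ?K] lookup_add sum.distrib distrib_right)
qed

lemma tensor_state_scale: "tensor_state \<phi> (pm_scale c s) = c * tensor_state \<phi> s"
proof -
  have "Poly_Mapping.keys (pm_scale c s) \<subseteq> Poly_Mapping.keys s" by (auto simp: in_keys_iff)
  then show ?thesis
    by (simp add: tensor_state_superset[of "Poly_Mapping.keys s"] sum_distrib_left mult.assoc)
qed

lemma tensor_state_single:
  "tensor_state \<phi> (Poly_Mapping.single (a, b) c) = c * (\<phi> a * \<phi> b)"
  by (simp add: tensor_state_superset[of "{(a, b)}"])

lemma tensor_state_sum: "tensor_state \<phi> (\<Sum>k\<in>K. f k) = (\<Sum>k\<in>K. tensor_state \<phi> (f k))"
  by (induction K rule: infinite_finite_induct)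
    (auto simp: tensor_state_add tensor_state_superset[of "{}"])

lemma tensor_state_lin_ext:
  "tensor_state \<phi> (lin_ext f s) =
    (\<Sum>k\<in>Poly_Mapping.keys s. Poly_Mapping.lookup s k * tensor_state \<phi> (f k))"
  by (simp add: lin_ext_def tensor_state_sum tensor_state_scale)

definition tensor_inner ::
  "('h::complex_hilbert_space bop \<Rightarrow> complex) \<Rightarrow> 'h tensor_rep \<Rightarrow> 'h tensor_rep \<Rightarrow> complex" where
  "tensor_inner \<phi> s t = tensor_state \<phi> (tensor_mult s (tensor_star t))"

lemma lin_ext_sum: "lin_ext f (\<Sum>k\<in>K. g k) = (\<Sum>k\<in>K. lin_ext f (g k))"
  by (induction K rule: infinite_finite_induct) (auto simp: lin_ext_add)

text \<open>
  The form is the sesquilinear extension of the product of two kernels, one for each leg.  The index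
  sets may exceed the supports, so that sums of tensors can be expanded over a common set.
\<close>

lemma tensor_inner_eq:
  assumes K: "finite K" "Poly_Mapping.keys s \<subseteq> K" and L: "finite L" "Poly_Mapping.keys t \<subseteq> L"
  shows "tensor_inner \<phi> s t = (\<Sum>k\<in>K. \<Sum>l\<in>L.
    Poly_Mapping.lookup s k * cnj (Poly_Mapping.lookup t l) *
      (\<phi> (fst k o\<^sub>L op_adjoint (fst l)) * \<phi> (op_adjoint (snd l) o\<^sub>L snd k)))"
proof -
  have "tensor_inner \<phi> s t =
    (\<Sum>k\<in>Poly_Mapping.keys s. Poly_Mapping.lookup s k *
      (\<Sum>l\<in>Poly_Mapping.keys t. cnj (Poly_Mapping.lookup t l) *
      (\<phi> (fst k o\<^sub>L op_adjoint (fst l)) * \<phi> (op_adjoint (snd l) o\<^sub>L snd k))))"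
    by (simp add: tensor_inner_def tensor_mult_def tensor_star_def tensor_state_lin_ext
        case_prod_unfold lin_ext_sum tensor_state_sum tensor_state_scale tensor_state_single)
  also have "\<dots> = (\<Sum>k\<in>Poly_Mapping.keys s. \<Sum>l\<in>L.
    Poly_Mapping.lookup s k * cnj (Poly_Mapping.lookup t l) *
      (\<phi> (fst k o\<^sub>L op_adjoint (fst l)) * \<phi> (op_adjoint (snd l) o\<^sub>L snd k)))"
    unfolding sum_distrib_left mult.assoc
    by (intro sum.cong refl sum.mono_neutral_left) (use L in \<open>auto simp: in_keys_iff\<close>)
  also have "\<dots> = (\<Sum>k\<in>K. \<Sum>l\<in>L.
    Poly_Mapping.lookup s k * cnj (Poly_Mapping.lookup t l) *
      (\<phi> (fst k o\<^sub>L op_adjoint (fst l)) * \<phi> (op_adjoint (snd l) o\<^sub>L snd k)))"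
    by (intro sum.mono_neutral_left) (use K in \<open>auto simp: in_keys_iff\<close>)
  finally show ?thesis .
qed

text \<open>
  Positivity is the Schur product theorem: the first leg contributes the Gram kernel of the form
  \<open>\<phi> (a b\<^sup>*)\<close>, and the second leg, because of the opposite multiplication, that of \<open>\<phi> (b\<^sup>* a)\<close>.
\<close>

lemma semi_inner_space_tensor:
  assumes row: "semi_inner_space M op_scale (\<lambda>a b. \<phi> (a o\<^sub>L op_adjoint b))"
    and col: "semi_inner_space M op_scale (\<lambda>a b. \<phi> (op_adjoint b o\<^sub>L a))"
  shows "semi_inner_space (tensor_algebra M) pm_scale (tensor_inner \<phi>)"
proof
  fix s t u :: "'a tensor_rep" and z :: complex
  interpret row: semi_inner_space M op_scale "\<lambda>a b. \<phi> (a o\<^sub>L op_adjoint b)" by (rule row)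
  interpret col: semi_inner_space M op_scale "\<lambda>a b. \<phi> (op_adjoint b o\<^sub>L a)" by (rule col)
  note [simp] = tensor_algebra_def
  show "0 \<in> tensor_algebra M" by simp
  show add: "s + t \<in> tensor_algebra M" if "s \<in> tensor_algebra M" "t \<in> tensor_algebra M"
    using that keys_add[of s t] by auto
  show "- s \<in> tensor_algebra M" if "s \<in> tensor_algebra M" using that by simp
  show scale: "pm_scale z s \<in> tensor_algebra M" if "s \<in> tensor_algebra M"
    using that by (auto simp: in_keys_iff)
  show "tensor_inner \<phi> (s + t) u = tensor_inner \<phi> s u + tensor_inner \<phi> t u"
  proof -
    let ?K = "Poly_Mapping.keys s \<union> Poly_Mapping.keys t"
    have "Poly_Mapping.keys (s + t) \<subseteq> ?K" by (rule keys_add)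
    then show ?thesis
      by (simp add: tensor_inner_eq[of ?K _ "Poly_Mapping.keys u"] lookup_add sum.distrib
          distrib_right)
  qed
  show "tensor_inner \<phi> (pm_scale z s) t = z * tensor_inner \<phi> s t"
  proof -
    have "Poly_Mapping.keys (pm_scale z s) \<subseteq> Poly_Mapping.keys s" by (auto simp: in_keys_iff)
    then show ?thesis
      by (simp add: tensor_inner_eq[of "Poly_Mapping.keys s" _ "Poly_Mapping.keys t"]
          sum_distrib_left mult.assoc)
  qed
  show "tensor_inner \<phi> t s = cnj (tensor_inner \<phi> s t)"
    if s: "s \<in> tensor_algebra M" and t: "t \<in> tensor_algebra M"
  proof -
    have "\<phi> (fst l o\<^sub>L op_adjoint (fst k)) * \<phi> (op_adjoint (snd k) o\<^sub>L snd l) =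
        cnj (\<phi> (fst k o\<^sub>L op_adjoint (fst l)) * \<phi> (op_adjoint (snd l) o\<^sub>L snd k))"
      if "k \<in> Poly_Mapping.keys s" "l \<in> Poly_Mapping.keys t" for k l
    proof -
      have "k \<in> M \<times> M" "l \<in> M \<times> M" using that s t by auto
      then show ?thesis
        using row.ip_commute[of "fst k" "fst l"] col.ip_commute[of "snd k" "snd l"]
        by (simp add: mem_Times_iff)
    qed
    then show ?thesis
      by (subst tensor_inner_eq[OF finite_keys subset_refl finite_keys subset_refl])
        (subst tensor_inner_eq[OF finite_keys subset_refl finite_keys subset_refl],
          subst sum.swap, simp add: mult.commute cong: sum.cong)
  qed
  show "0 \<le> Re (tensor_inner \<phi> s s)" if s: "s \<in> tensor_algebra M"
  proof -
    have "psd_on (Poly_Mapping.keys s) (\<lambda>k l. \<phi> (fst k o\<^sub>L op_adjoint (fst l)) *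
        \<phi> (op_adjoint (snd l) o\<^sub>L snd k))"
      using s by (intro schur_product row.gram_psd_on[of _ fst] col.gram_psd_on[of _ snd]) auto
    then show ?thesis
      by (subst tensor_inner_eq[OF finite_keys subset_refl finite_keys subset_refl])
        (rule psd_onD(2))
  qed
qed

section \<open>Operators, adjoints and commutants\<close>

lemma cinner_add_right: "cinner z (x + y) = cinner z x + cinner z y"
  for x y z :: "'h::complex_hilbert_space"
  by (metis cinner_add_left cinner_commute complex_cnj_add)

lemma cinner_scaleC_right: "cinner x (c *\<^sub>C y) = cnj c * cinner x y"
  for x y :: "'h::complex_hilbert_space"
  by (metis cinner_scaleC_left cinner_commute complex_cnj_mult)

lemma cinner_left_cancel:
  fixes a b :: "'h::complex_hilbert_space"
  assumes "\<And>x. cinner x a = cinner x b"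
  shows "a = b"
proof -
  have "cinner (a - b) a = cinner (a - b) (a - b) + cinner (a - b) b"
    using cinner_add_right[of "a - b" "a - b" b] by simp
  then have "cinner (a - b) (a - b) = 0" using assms[of "a - b"] by simp
  then show ?thesis by (simp add: cinner_norm)
qed

lemma op_adjoint_eq:
  assumes "is_op_adjoint T S"
  shows "op_adjoint T = S"
  unfolding op_adjoint_def
proof (rule the_equality)
  show "is_op_adjoint T S" by (rule assms)
next
  fix S' assume S': "is_op_adjoint T S'"
  show "S' = S"
  proof (rule blinfun_eqI, rule cinner_left_cancel)
    show "cinner x (blinfun_apply S' y) = cinner x (blinfun_apply S y)" for x y
      using assms S' unfolding is_op_adjoint_def by metis
  qed
qed

lemma is_op_adjoint_commute: "is_op_adjoint T S \<Longrightarrow> is_op_adjoint S T"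
  unfolding is_op_adjoint_def by (metis cinner_commute)

lemma is_op_adjoint_add:
  "is_op_adjoint S S' \<Longrightarrow> is_op_adjoint T T' \<Longrightarrow> is_op_adjoint (S + T) (S' + T')"
  by (simp add: is_op_adjoint_def blinfun.add_left cinner_add_left cinner_add_right)

lemma is_op_adjoint_scale:
  "is_op_adjoint T T' \<Longrightarrow> is_op_adjoint (op_scale c T) (op_scale (cnj c) T')"
  by (simp add: is_op_adjoint_def op_scale_apply cinner_scaleC_left cinner_scaleC_right)

lemma is_op_adjoint_compose:
  "is_op_adjoint S S' \<Longrightarrow> is_op_adjoint T T' \<Longrightarrow> is_op_adjoint (S o\<^sub>L T) (T' o\<^sub>L S')"
  by (simp add: is_op_adjoint_def)

lemma is_op_adjoint_id: "is_op_adjoint id_blinfun (id_blinfun :: 'h::complex_hilbert_space bop)"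
  by (simp add: is_op_adjoint_def)

lemma self_adjoint_op_adjoint: "self_adjoint T \<Longrightarrow> op_adjoint T = T"
  by (simp add: self_adjoint_def op_adjoint_eq)

lemmas blinfun_compose_add_left = bounded_bilinear.add_left[OF bounded_bilinear_blinfun_compose]
lemmas blinfun_compose_add_right = bounded_bilinear.add_right[OF bounded_bilinear_blinfun_compose]

lemma compose_id_blinfun [simp]: "id_blinfun o\<^sub>L T = T" "T o\<^sub>L id_blinfun = T"
  by (simp_all add: blinfun_eqI)

lemma compose_assoc: "(R o\<^sub>L S) o\<^sub>L T = R o\<^sub>L (S o\<^sub>L T)"
  by (rule blinfun_eqI) simp

lemma op_scale_compose_left: "op_scale c S o\<^sub>L T = op_scale c (S o\<^sub>L T)"
  by (rule blinfun_eqI) (simp add: op_scale_apply)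

lemma op_scale_compose_right:
  "S \<in> bounded_operators \<Longrightarrow> S o\<^sub>L op_scale c T = op_scale c (S o\<^sub>L T)"
  by (rule blinfun_eqI) (simp add: op_scale_apply bounded_operators_def)

lemma op_scale_simps:
  "op_scale c (S + T) = op_scale c S + op_scale c T"
  "op_scale (c + d) T = op_scale c T + op_scale d T"
  "op_scale c (op_scale d T) = op_scale (c * d) T"
  "op_scale 1 T = T"
  using scaleC_of_real[of 1]
  by (auto intro!: blinfun_eqI
      simp: op_scale_apply blinfun.add_left scaleC_add_left scaleC_add_right scaleC_scaleC)

lemma op_scale_zero [simp]: "op_scale 0 T = 0" "op_scale c 0 = 0"
  using op_scale_simps(2)[of 0 0 T] op_scale_simps(1)[of c 0 0] by simp_all

lemma op_scale_minus_one: "op_scale (- 1) T = - T"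
  using op_scale_simps(2)[of 1 "- 1" T] op_scale_simps(4)[of T] by (simp add: eq_neg_iff_add_eq_0 add.commute)

text \<open>
  A von Neumann algebra is the commutant of its commutant, so its closure under the algebra
  operations follows from that of commutants.
\<close>

lemma commutant_closed:
  assumes A: "A \<subseteq> bounded_operators"
  shows "id_blinfun \<in> commutant A"
    and "S \<in> commutant A \<Longrightarrow> T \<in> commutant A \<Longrightarrow> S + T \<in> commutant A"
    and "T \<in> commutant A \<Longrightarrow> op_scale c T \<in> commutant A"
    and "S \<in> commutant A \<Longrightarrow> T \<in> commutant A \<Longrightarrow> S o\<^sub>L T \<in> commutant A"
proof -
  show "id_blinfun \<in> commutant A"
    by (auto simp: commutant_def bounded_operators_def intro: blinfun_eqI)
  show "S + T \<in> commutant A" if "S \<in> commutant A" "T \<in> commutant A"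
    using that by (simp add: commutant_def bounded_operators_def blinfun.add_left scaleC_add_right
        blinfun_compose_add_left blinfun_compose_add_right)
  show "op_scale c T \<in> commutant A" if "T \<in> commutant A"
    using that A by (auto simp: commutant_def op_scale_compose_left op_scale_compose_right)
      (simp add: bounded_operators_def op_scale_apply scaleC_scaleC mult.commute)
  show "S o\<^sub>L T \<in> commutant A" if "S \<in> commutant A" "T \<in> commutant A"
    using that by (simp add: commutant_def bounded_operators_def)
      (metis compose_assoc)
qed

section \<open>Von Neumann algebras with a state\<close>

locale vn_algebra_with_state =
  fixes M :: "'h::complex_hilbert_space bop set" and \<phi> :: "'h bop \<Rightarrow> complex"
  assumes vn: "von_neumann_algebra M" and state: "state_on M \<phi>"
begin

lemma M_bounded: "T \<in> M \<Longrightarrow> T \<in> bounded_operators"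
  using vn by (auto simp: von_neumann_algebra_def)

lemma M_closed:
  shows id_mem: "id_blinfun \<in> M"
    and M_add: "S \<in> M \<Longrightarrow> T \<in> M \<Longrightarrow> S + T \<in> M"
    and M_scale: "T \<in> M \<Longrightarrow> op_scale c T \<in> M"
    and M_compose: "S \<in> M \<Longrightarrow> T \<in> M \<Longrightarrow> S o\<^sub>L T \<in> M"
proof -
  have "commutant M \<subseteq> bounded_operators" by (auto simp: commutant_def)
  note c = commutant_closed[OF this]
  have "commutant (commutant M) = M" using vn by (simp add: von_neumann_algebra_def)
  note c = c[unfolded this]
  show "id_blinfun \<in> M"
    "S \<in> M \<Longrightarrow> T \<in> M \<Longrightarrow> S + T \<in> M"
    "T \<in> M \<Longrightarrow> op_scale c T \<in> M"
    "S \<in> M \<Longrightarrow> T \<in> M \<Longrightarrow> S o\<^sub>L T \<in> M"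
    by (fact c)+
qed

lemma M_zero: "0 \<in> M"
  using M_scale[OF id_mem, of 0] by simp

lemma M_minus: "T \<in> M \<Longrightarrow> - T \<in> M"
  using M_scale[of T "- 1"] by (simp add: op_scale_minus_one)

lemma op_adjoint_M:
  assumes "T \<in> M"
  shows op_adjoint_mem: "op_adjoint T \<in> M"
    and is_op_adjoint_op_adjoint: "is_op_adjoint T (op_adjoint T)"
    and op_adjoint_op_adjoint: "op_adjoint (op_adjoint T) = T"
proof -
  obtain S where S: "S \<in> M" "is_op_adjoint T S"
    using assms vn by (auto simp: von_neumann_algebra_def)
  have eq: "op_adjoint T = S" by (rule op_adjoint_eq[OF S(2)])
  show "op_adjoint T \<in> M" "is_op_adjoint T (op_adjoint T)" using S eq by simp_all
  show "op_adjoint (op_adjoint T) = T"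
    unfolding eq by (rule op_adjoint_eq[OF is_op_adjoint_commute[OF S(2)]])
qed

lemma op_adjoint_compose:
  assumes "S \<in> M" "T \<in> M"
  shows "op_adjoint (S o\<^sub>L T) = op_adjoint T o\<^sub>L op_adjoint S"
  using assms by (intro op_adjoint_eq is_op_adjoint_compose is_op_adjoint_op_adjoint)

lemma state_add: "S \<in> M \<Longrightarrow> T \<in> M \<Longrightarrow> \<phi> (S + T) = \<phi> S + \<phi> T"
  and state_scale: "T \<in> M \<Longrightarrow> \<phi> (op_scale c T) = c * \<phi> T"
  and state_nonneg: "T \<in> M \<Longrightarrow> \<phi> (op_adjoint T o\<^sub>L T) \<in> \<real>\<^sub>\<ge>\<^sub>0"
  and state_id: "\<phi> id_blinfun = 1"
  using state by (auto simp: state_on_def)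

text \<open>
  Positive functionals are Hermitian: the value of \<open>\<phi>\<close> at \<open>(T + c)\<^sup>* (T + c)\<close> is real, and the cross terms
  for \<open>c = 1\<close> and \<open>c = \<i>\<close> determine the imaginary and the real part of \<open>\<phi> (T\<^sup>*)\<close>.
\<close>

lemma state_op_adjoint:
  assumes T: "T \<in> M"
  shows "\<phi> (op_adjoint T) = cnj (\<phi> T)"
proof -
  let ?T' = "op_adjoint T"
  have T': "?T' \<in> M" by (rule op_adjoint_mem[OF T])
  have "Im (cnj c * \<phi> T + c * \<phi> ?T') = 0" for c
  proof -
    let ?c = "op_scale c id_blinfun" and ?c' = "op_scale (cnj c) id_blinfun"
    have adj: "op_adjoint (T + ?c) = ?T' + ?c'"
      by (intro op_adjoint_eq is_op_adjoint_add is_op_adjoint_scale is_op_adjoint_id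
          is_op_adjoint_op_adjoint T)
    have "op_adjoint (T + ?c) o\<^sub>L (T + ?c)
        = ((?T' o\<^sub>L T) + op_scale (cnj c) T) + (op_scale c ?T' + op_scale (cnj c * c) id_blinfun)"
      unfolding adj
      by (simp add: blinfun_compose_add_left blinfun_compose_add_right op_scale_compose_left
          op_scale_compose_right[OF M_bounded[OF T']] op_scale_compose_right[OF M_bounded[OF id_mem]]
          op_scale_simps)
    then have "\<phi> (op_adjoint (T + ?c) o\<^sub>L (T + ?c))
        = (\<phi> (?T' o\<^sub>L T) + cnj c * \<phi> T) + (c * \<phi> ?T' + cnj c * c)"
      using T T' by (simp add: state_add state_scale state_id M_add M_scale M_compose id_mem)
    moreover have "\<phi> (op_adjoint (T + ?c) o\<^sub>L (T + ?c)) \<in> \<real>\<^sub>\<ge>\<^sub>0" "\<phi> (?T' o\<^sub>L T) \<in> \<real>\<^sub>\<ge>\<^sub>0"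
      by (intro state_nonneg M_add M_scale id_mem T)+
    ultimately show ?thesis by (simp add: complex_nonneg_Reals_iff algebra_simps)
  qed
  from this[of 1] this[of \<i>] show ?thesis by (simp add: complex_eq_iff)
qed

lemma semi_inner_space_row: "semi_inner_space M op_scale (\<lambda>a b. \<phi> (a o\<^sub>L op_adjoint b))"
proof
  fix a b c z assume a: "a \<in> M" and b: "b \<in> M"
  show "\<phi> ((a + b) o\<^sub>L op_adjoint c) = \<phi> (a o\<^sub>L op_adjoint c) + \<phi> (b o\<^sub>L op_adjoint c)"
    if "c \<in> M"
    using a b that by (simp add: blinfun_compose_add_left state_add M_compose op_adjoint_mem)
  show "\<phi> (op_scale z a o\<^sub>L op_adjoint b) = z * \<phi> (a o\<^sub>L op_adjoint b)"
    using a b by (simp add: op_scale_compose_left state_scale M_compose op_adjoint_mem)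
  show "\<phi> (b o\<^sub>L op_adjoint a) = cnj (\<phi> (a o\<^sub>L op_adjoint b))"
    using a b
    by (simp add: state_op_adjoint[symmetric] op_adjoint_compose op_adjoint_op_adjoint
        op_adjoint_mem M_compose)
next
  fix a assume "a \<in> M"
  then show "0 \<le> Re (\<phi> (a o\<^sub>L op_adjoint a))"
    using state_nonneg[OF op_adjoint_mem, of a]
    by (simp add: op_adjoint_op_adjoint complex_nonneg_Reals_iff)
qed (use M_zero M_add M_minus M_scale in auto)

lemma semi_inner_space_column: "semi_inner_space M op_scale (\<lambda>a b. \<phi> (op_adjoint b o\<^sub>L a))"
proof
  fix a b c z assume a: "a \<in> M" and b: "b \<in> M"
  show "\<phi> (op_adjoint c o\<^sub>L (a + b)) = \<phi> (op_adjoint c o\<^sub>L a) + \<phi> (op_adjoint c o\<^sub>L b)"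
    if "c \<in> M"
    using a b that by (simp add: blinfun_compose_add_right state_add M_compose op_adjoint_mem)
  show "\<phi> (op_adjoint b o\<^sub>L op_scale z a) = z * \<phi> (op_adjoint b o\<^sub>L a)"
    using a b
    by (simp add: op_scale_compose_right M_bounded state_scale M_compose op_adjoint_mem)
  show "\<phi> (op_adjoint a o\<^sub>L b) = cnj (\<phi> (op_adjoint b o\<^sub>L a))"
    using a b
    by (simp add: state_op_adjoint[symmetric] op_adjoint_compose op_adjoint_op_adjoint
        op_adjoint_mem M_compose)
next
  fix a assume "a \<in> M"
  then show "0 \<le> Re (\<phi> (op_adjoint a o\<^sub>L a))"
    using state_nonneg[of a] by (simp add: complex_nonneg_Reals_iff)
qed (use M_zero M_add M_minus M_scale in auto)

lemma semi_inner_space_tuples: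
  "semi_inner_space {Y :: 'h bop ^ 'n::finite. \<forall>i. Y $ i \<in> M} (\<lambda>z Y. \<chi> i. op_scale z (Y $ i))
    (tuple_inner \<phi>)"
  using semi_inner_space_vec[OF semi_inner_space_row] by (simp add: tuple_inner_def[abs_def])

lemma matrix_inner_eq: "matrix_inner \<phi> A B = (\<Sum>i\<in>UNIV. \<Sum>j\<in>UNIV. tensor_inner \<phi> (A $ i $ j) (B $ i $ j))"
  by (simp add: matrix_inner_def tensor_inner_def)

lemma semi_inner_space_matrices:
  "semi_inner_space (tensor_matrices M :: ('h tensor_rep ^ 'n::finite ^ 'n) set)
    (\<lambda>z A. \<chi> i j. pm_scale z (A $ i $ j)) (matrix_inner \<phi>)"
  using semi_inner_space_vec[OF semi_inner_space_vec[OF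
        semi_inner_space_tensor[OF semi_inner_space_row semi_inner_space_column]]]
  by (simp add: matrix_inner_eq[abs_def] tensor_matrices_def)

end

section \<open>Evaluation of polynomials and the quadratic potential\<close>

lemma nc_eval_superset:
  assumes "finite K" "Poly_Mapping.keys P \<subseteq> K"
  shows "nc_eval X P = (\<Sum>w\<in>K. op_scale (Poly_Mapping.lookup P w) (word_eval X w))"
  unfolding nc_eval_def by (rule sum.mono_neutral_left) (use assms in \<open>auto simp: in_keys_iff\<close>)

lemma nc_eval_add: "nc_eval X (P + Q) = nc_eval X P + nc_eval X Q"
proof -
  let ?K = "Poly_Mapping.keys P \<union> Poly_Mapping.keys Q"
  have "finite ?K" "Poly_Mapping.keys (P + Q) \<subseteq> ?K" by (auto simp: keys_add)
  then show ?thesis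
    by (simp add: nc_eval_superset[of ?K] lookup_add sum.distrib op_scale_simps)
qed

lemma op_scale_sum: "op_scale c (\<Sum>k\<in>K. f k) = (\<Sum>k\<in>K. op_scale c (f k))"
  by (induction K rule: infinite_finite_induct) (auto simp: op_scale_simps)

lemma nc_eval_scale: "nc_eval X (pm_scale c P) = op_scale c (nc_eval X P)"
proof -
  have "Poly_Mapping.keys (pm_scale c P) \<subseteq> Poly_Mapping.keys P" by (auto simp: in_keys_iff)
  then show ?thesis
    by (simp add: nc_eval_superset[of "Poly_Mapping.keys P"] op_scale_sum op_scale_simps)
qed

lemma nc_eval_var: "nc_eval X (nc_var i) = X $ i"
  by (simp add: nc_var_def nc_eval_superset[of "{Word [i]}"] word_eval_def op_scale_simps)

lemma nc_eval2_one:
  fixes X :: "'h::complex_hilbert_space bop ^ 'n::finite"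
  shows "nc_eval2 X (1 \<otimes>\<^sub>P 1) = Poly_Mapping.single (id_blinfun, id_blinfun) 1"
proof -
  have "(1 :: 'n nc_poly) \<otimes>\<^sub>P 1 = Poly_Mapping.single (Word [], Word []) 1"
    unfolding nc_tensor_one_one by (metis single_one zero_nc_word_def zero_prod_def)
  then show ?thesis by (simp add: nc_eval2_def word_eval_def del: single_one)
qed

context vn_algebra_with_state
begin

lemma word_eval_mem:
  assumes "\<And>i. X $ i \<in> M"
  shows "word_eval X w \<in> M"
proof -
  have "foldr (\<lambda>i T. X $ i o\<^sub>L T) ls id_blinfun \<in> M" for ls
    by (induction ls) (auto intro: assms M_compose id_mem)
  then show ?thesis by (simp add: word_eval_def)
qed

lemma nc_eval_mem:
  assumes "\<And>i. X $ i \<in> M"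
  shows "nc_eval X P \<in> M"
proof -
  interpret row: semi_inner_space M op_scale "\<lambda>a b. \<phi> (a o\<^sub>L op_adjoint b)"
    by (rule semi_inner_space_row)
  show ?thesis unfolding nc_eval_def by (intro row.sum_mem M_scale word_eval_mem assms)
qed

lemma nc_eval2_mem:
  assumes "\<And>i. X $ i \<in> M"
  shows "nc_eval2 X T \<in> tensor_algebra M"
  unfolding nc_eval2_def
proof (induction T rule: pm_induct)
  case (single k c)
  then show ?case by (auto simp: tensor_algebra_def case_prod_unfold word_eval_mem assms)
next
  case (add S T)
  then show ?case
    using keys_add[of "nc_eval2 X S" "nc_eval2 X T"]
    by (auto simp: tensor_algebra_def nc_eval2_def lin_ext_add)
qed (simp add: tensor_algebra_def)

end

lemma cyclic_deriv_square:
  "cyclic_deriv i (nc_var j ^ 2) = (if i = j then pm_scale 2 (nc_var j) else 0)"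
proof -
  note D = is_nc_derivativeD[OF nc_deriv]
  have one: "(1 :: 'a nc_poly) = Poly_Mapping.single 0 1" by simp
  have "nc_deriv i (nc_var j * nc_var j) = (if i = j then
     Poly_Mapping.single (0, Word [j]) 1 + Poly_Mapping.single (Word [j], 0) 1 else 0)"
    unfolding D(4) D(3) nc_ract_def nc_lact_def nc_tensor_one_one
    by (auto simp: nc_var_def one nc_tensor_single simp del: single_one)
  then show ?thesis
    by (auto simp: cyclic_deriv_def power2_eq_square nc_flip_def nc_mult_def lin_ext_add nc_var_def
        simp flip: single_add)
qed

lemma cyclic_deriv_add: "cyclic_deriv i (P + Q) = cyclic_deriv i P + cyclic_deriv i Q"
  by (simp add: cyclic_deriv_def nc_deriv_eq nc_flip_def nc_mult_def lin_ext_add)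

lemma cyclic_deriv_scale: "cyclic_deriv i (pm_scale c P) = pm_scale c (cyclic_deriv i P)"
  by (simp add: cyclic_deriv_def nc_deriv_eq nc_flip_def nc_mult_def lin_ext_scale)

lemma cyclic_deriv_sum: "cyclic_deriv i (\<Sum>k\<in>K. f k) = (\<Sum>k\<in>K. cyclic_deriv i (f k))"
  by (induction K rule: infinite_finite_induct)
    (auto simp: cyclic_deriv_add cyclic_deriv_scale[of i 0 0, simplified])

lemma cyclic_gradient_quadratic:
  "cyclic_gradient (pm_scale (1/2) (\<Sum>i\<in>UNIV. nc_var i ^ 2)) = (\<chi> i::'n::finite. nc_var i)"
  by (simp add: cyclic_gradient_def vec_eq_iff cyclic_deriv_scale cyclic_deriv_sum
      cyclic_deriv_square)

section \<open>The free Stein kernel of a free Poincare inequality\<close>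

text \<open>
  This makes tuples of polynomials themselves a space with the form \<open>\<langle>J P, J Q\<rangle>\<close> of their Jacobians.
  Functionals of \<open>P\<close> need not be factored through \<open>J P\<close> before the Riesz theorem is applied.
\<close>

lemma semi_inner_space_pullback:
  assumes "semi_inner_space E sc ip"
    and add: "\<And>a b. J (a + b) = J a + J b" and scale: "\<And>z a. J (sc' z a) = sc z (J a)"
    and mem: "\<And>a. J a \<in> E"
  shows "semi_inner_space UNIV sc' (\<lambda>a b. ip (J a) (J b))"
proof -
  interpret semi_inner_space E sc ip by (rule assms)
  show ?thesis
    by unfold_locales (auto simp: add scale mem ip_add_left ip_sc_left ip_nonneg intro: ip_commute)
qed

lemma eval_jacobian_add:
  "eval_matrix X (jacobian (P + Q)) = eval_matrix X (jacobian P) + eval_matrix X (jacobian Q)"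
  by (simp add: eval_matrix_def jacobian_def vec_eq_iff nc_eval2_def nc_deriv_eq lin_ext_add)

lemma eval_jacobian_scale:
  "eval_matrix X (jacobian (\<chi> i. pm_scale z (P $ i))) =
    (\<chi> i j. pm_scale z (eval_matrix X (jacobian P) $ i $ j))"
  by (simp add: eval_matrix_def jacobian_def vec_eq_iff nc_eval2_def nc_deriv_eq lin_ext_scale)

lemma eval_jacobian_var: "eval_matrix X (jacobian (\<chi> i. nc_var i)) = matrix_id"
  by (auto simp: eval_matrix_def jacobian_def matrix_id_def vec_eq_iff nc_eval2_one
      is_nc_derivativeD(3)[OF nc_deriv]) (auto simp: nc_eval2_def)

lemma eval_tuple_var: "eval_tuple X (\<chi> i. nc_var i) = X"
  by (simp add: eval_tuple_def vec_eq_iff nc_eval_var)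

context vn_algebra_with_state
begin

lemma matrix_inner_id: "matrix_inner \<phi> matrix_id (matrix_id :: _ ^ 'n ^ 'n) = of_nat CARD('n::finite)"
proof -
  have adj: "op_adjoint id_blinfun = (id_blinfun :: 'h bop)"
    by (rule op_adjoint_eq[OF is_op_adjoint_id])
  have "tensor_inner \<phi> (Poly_Mapping.single (id_blinfun, id_blinfun) 1)
      (Poly_Mapping.single (id_blinfun, id_blinfun) 1) = 1"
    by (subst tensor_inner_eq[of "{(id_blinfun, id_blinfun)}" _ "{(id_blinfun, id_blinfun)}"])
      (auto simp: adj state_id)
  moreover have "tensor_inner \<phi> 0 0 = 0"
    by (simp add: tensor_inner_eq[of "{}" _ "{}"])
  ultimately have "tensor_inner \<phi> (matrix_id $ i $ j) (matrix_id $ i $ j) = (if i = j then 1 else 0)"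
    for i j :: 'n
    by (simp add: matrix_id_def)
  then show ?thesis by (simp add: matrix_inner_eq)
qed

text \<open>
  Since the \<open>x\<^sub>i\<close> are centered, replacing \<open>P\<^sub>i(X)\<close> by \<open>Y\<^sub>i = P\<^sub>i(X) - \<phi>(P\<^sub>i(X))\<close> does not change the pairing
  with \<open>X\<close>.  Cauchy-Schwarz for tuples leaves the length of \<open>Y\<close>, to which the Poincare inequality
  applies in each entry.
\<close>

lemma tuple_inner_poincare_bound:
  fixes X :: "'h bop ^ 'n::finite"
  assumes X: "\<And>i. X $ i \<in> M" and centered: "\<And>i. \<phi> (X $ i) = 0"
    and poincare: "free_poincare \<phi> X c"
  shows "(cmod (tuple_inner \<phi> X (eval_tuple X P)))\<^sup>2 \<le> Re (tuple_inner \<phi> X X) *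
    (c * Re (matrix_inner \<phi> (eval_matrix X (jacobian P)) (eval_matrix X (jacobian P))))"
proof -
  interpret row: semi_inner_space M op_scale "\<lambda>a b. \<phi> (a o\<^sub>L op_adjoint b)"
    by (rule semi_inner_space_row)
  interpret tup: semi_inner_space "{Y :: 'h bop ^ 'n. \<forall>i. Y $ i \<in> M}"
    "\<lambda>z Y. \<chi> i. op_scale z (Y $ i)" "tuple_inner \<phi>"
    by (rule semi_inner_space_tuples)
  interpret tensor: semi_inner_space "tensor_algebra M" pm_scale "tensor_inner \<phi>"
    by (rule semi_inner_space_tensor[OF semi_inner_space_row semi_inner_space_column])
  define Y :: "'h bop ^ 'n" where
    "Y = (\<chi> i. nc_eval X (P $ i) - op_scale (\<phi> (nc_eval X (P $ i))) id_blinfun)"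
  have P: "nc_eval X (P $ i) \<in> M" for i by (rule nc_eval_mem[OF X])
  have Y: "Y $ i \<in> M" for i
    unfolding Y_def by (simp add: row.diff_mem P M_scale id_mem)
  have adj: "op_adjoint id_blinfun = (id_blinfun :: 'h bop)"
    by (rule op_adjoint_eq[OF is_op_adjoint_id])
  have "tuple_inner \<phi> X Y = tuple_inner \<phi> X (eval_tuple X P)"
    unfolding tuple_inner_def
    by (intro sum.cong refl)
      (simp add: Y_def eval_tuple_def row.ip_diff_right row.ip_sc_right X P id_mem M_scale adj centered)
  moreover have "(cmod (tuple_inner \<phi> X Y))\<^sup>2 \<le> Re (tuple_inner \<phi> X X) * Re (tuple_inner \<phi> Y Y)"
    by (rule tup.cauchy_schwarz) (simp_all add: X Y)
  moreover have "Re (tuple_inner \<phi> Y Y) \<le>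
    c * Re (matrix_inner \<phi> (eval_matrix X (jacobian P)) (eval_matrix X (jacobian P)))"
  proof -
    have "Re (\<phi> (Y $ i o\<^sub>L op_adjoint (Y $ i))) \<le> c * (\<Sum>j\<in>UNIV. Re (tensor_inner \<phi>
        (nc_eval2 X (nc_deriv j (P $ i))) (nc_eval2 X (nc_deriv j (P $ i)))))" for i
    proof -
      have "Re (\<phi> (Y $ i o\<^sub>L op_adjoint (Y $ i))) = (op_norm2 \<phi> (Y $ i))\<^sup>2"
        by (simp add: op_norm2_def row.ip_nonneg Y)
      also have "\<dots> \<le> c * (\<Sum>j\<in>UNIV. (tensor_norm2 \<phi> (nc_eval2 X (nc_deriv j (P $ i))))\<^sup>2)"
        using poincare by (simp add: free_poincare_def Y_def)
      also have "(\<Sum>j\<in>UNIV. (tensor_norm2 \<phi> (nc_eval2 X (nc_deriv j (P $ i))))\<^sup>2) =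
          (\<Sum>j\<in>UNIV. Re (tensor_inner \<phi>
            (nc_eval2 X (nc_deriv j (P $ i))) (nc_eval2 X (nc_deriv j (P $ i)))))"
        by (simp add: tensor_norm2_def tensor_inner_def[symmetric] tensor.ip_nonneg nc_eval2_mem X)
      finally show ?thesis .
    qed
    then show ?thesis
      by (simp add: tuple_inner_def matrix_inner_eq eval_matrix_def jacobian_def sum_distrib_left
          sum_mono)
  qed
  moreover have "0 \<le> Re (tuple_inner \<phi> X X)" by (rule tup.ip_nonneg) (simp add: X)
  ultimately show ?thesis by (metis (no_types, lifting) mult_left_mono order_trans)
qed

text \<open>
  The potential \<open>V\<close> enters only through \<open>[DV](X) = X\<close>.  The kernel \<open>A\<close> represents \<open>P \<mapsto> \<langle>X, P(X)\<rangle>\<close> within the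
  closure of the Jacobians, so \<open>\<parallel>A\<parallel>\<^sup>2 \<le> n * c\<close>.  The unit matrix \<open>I\<close> is the Jacobian of \<open>P = t\<close>, hence \<open>\<langle>A, I\<rangle> = \<langle>X, X\<rangle> = n\<close>
  and \<open>\<parallel>A - I\<parallel>\<^sup>2 = \<parallel>A\<parallel>\<^sup>2 - n\<close>.
\<close>

lemma stein_kernel_of_poincare:
  fixes X :: "'h bop ^ 'n::finite"
  assumes X: "\<And>i. X $ i \<in> M" and centered: "\<And>i. \<phi> (X $ i) = 0"
    and normalized: "tuple_inner \<phi> X X = of_nat CARD('n)"
    and poincare: "free_poincare \<phi> X c"
    and V: "cyclic_gradient V = (\<chi> i. nc_var i)"
  obtains A where "free_stein_kernel M \<phi> X V A"
    "(completion_norm (matrix_inner \<phi>) (completion_diff (tensor_matrices M) (matrix_inner \<phi>) A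
      (completion_embed (tensor_matrices M) (matrix_inner \<phi>) matrix_id)))\<^sup>2
      \<le> real CARD('n) * (c - 1)"
proof -
  let ?E = "tensor_matrices M :: ('h tensor_rep ^ 'n ^ 'n) set"
  let ?n = "real CARD('n)" and ?I = "matrix_id :: 'h tensor_rep ^ 'n ^ 'n"
  interpret mat: semi_inner_space ?E "\<lambda>z A. \<chi> i j. pm_scale z (A $ i $ j)" "matrix_inner \<phi>"
    by (rule semi_inner_space_matrices)
  interpret tup: semi_inner_space "{Y :: 'h bop ^ 'n. \<forall>i. Y $ i \<in> M}"
    "\<lambda>z Y. \<chi> i. op_scale z (Y $ i)" "tuple_inner \<phi>"
    by (rule semi_inner_space_tuples)
  define J where "J P = eval_matrix X (jacobian P)" for P :: "'n nc_poly ^ 'n"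
  define f where "f P = tuple_inner \<phi> X (eval_tuple X P)" for P
  have J_mem: "J P \<in> ?E" for P
    by (simp add: J_def tensor_matrices_def eval_matrix_def nc_eval2_mem X)
  have J_add: "J (P + Q) = J P + J Q" for P Q by (simp add: J_def eval_jacobian_add)
  have J_diff: "J (P - Q) = J P - J Q" for P Q using J_add[of "P - Q" Q] by simp
  have J_var: "J (\<chi> i. nc_var i) = ?I" by (simp add: J_def eval_jacobian_var)
  have I_mem: "?I \<in> ?E" using J_mem[of "\<chi> i. nc_var i"] by (simp add: J_var)
  interpret poly: semi_inner_space UNIV "\<lambda>z P. \<chi> i. pm_scale z (P $ i)"
    "\<lambda>P Q. matrix_inner \<phi> (J P) (J Q)"
    by (rule semi_inner_space_pullback[OF semi_inner_space_matrices J_add _ J_mem])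
      (simp add: J_def eval_jacobian_scale)
  have eval_mem: "eval_tuple X P \<in> {Y. \<forall>i. Y $ i \<in> M}" for P
    by (simp add: eval_tuple_def nc_eval_mem X)
  have X_mem: "X \<in> {Y. \<forall>i. Y $ i \<in> M}" by (simp add: X)
  have f_add: "f (P + Q) = f P + f Q" for P Q
  proof -
    have "eval_tuple X (P + Q) = eval_tuple X P + eval_tuple X Q"
      by (simp add: eval_tuple_def vec_eq_iff nc_eval_add)
    then show ?thesis by (simp only: f_def tup.ip_add_right[OF eval_mem eval_mem X_mem])
  qed
  have f_scale: "f (\<chi> i. pm_scale z (P $ i)) = cnj z * f P" for z P
  proof -
    have "eval_tuple X (\<chi> i. pm_scale z (P $ i)) = (\<chi> i. op_scale z (eval_tuple X P $ i))"
      by (simp add: eval_tuple_def vec_eq_iff nc_eval_scale)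
    then show ?thesis by (simp only: f_def tup.ip_sc_right[OF X_mem eval_mem])
  qed
  have bound: "(cmod (f P))\<^sup>2 \<le> ?n * c * Re (matrix_inner \<phi> (J P) (J P))" for P
    using tuple_inner_poincare_bound[OF X centered poincare, of P]
    by (simp add: f_def J_def normalized mult.assoc)
  have f_var: "f (\<chi> i. nc_var i) = of_nat CARD('n)"
    by (simp add: f_def eval_tuple_var normalized)
  \<comment> \<open>testing the bound at \<open>P = t\<close> shows that a Poincare constant cannot be negative\<close>
  have "?n\<^sup>2 \<le> ?n * c * ?n"
    using bound[of "\<chi> i. nc_var i"] by (simp add: f_var J_var matrix_inner_id)
  then have "0 \<le> ?n * c" by (simp add: power2_eq_square)
  with f_add f_scale bound obtain p L where
    p: "p \<in> form_cauchy UNIV (\<lambda>P Q. matrix_inner \<phi> (J P) (J Q))" and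
    rep: "\<And>Q. (\<lambda>k. matrix_inner \<phi> (J (p k)) (J Q)) \<longlonglongrightarrow> f Q" and
    L: "(\<lambda>k. matrix_inner \<phi> (J (p k)) (J (p k))) \<longlonglongrightarrow> complex_of_real L" "L \<le> ?n * c"
    by (rule poly.riesz_sequence[of f "?n * c"]) auto
  \<comment> \<open>\<open>L\<close> is the squared length of the kernel represented by \<open>s\<close>\<close>
  define s where "s k = J (p k)" for k
  have s: "s \<in> form_cauchy ?E (matrix_inner \<phi>)"
    using p by (simp add: form_cauchy_def form_norm_def s_def J_mem J_diff)
  let ?rel = "form_rel ?E (matrix_inner \<phi>)"
  have stein: "free_stein_kernel M \<phi> X V (?rel `` {s})"
    unfolding free_stein_kernel_def
  proof (intro conjI allI)
    show "?rel `` {s} \<in> L2_matrices M \<phi>"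
      unfolding L2_matrices_def completion_def using s by (rule quotientI)
    show "tuple_inner \<phi> (eval_tuple X (cyclic_gradient V)) (eval_tuple X P) =
      completion_inner (matrix_inner \<phi>) (?rel `` {s})
        (completion_embed ?E (matrix_inner \<phi>) (eval_matrix X (jacobian P)))" for P
      unfolding V eval_tuple_var completion_embed_def
      using mat.completion_inner_eq[OF s mat.form_cauchy_const[OF J_mem], of P "f P"] rep[of P]
      by (simp add: s_def f_def J_def)
  qed
  have "(\<lambda>k. matrix_inner \<phi> (s k - ?I) (s k - ?I)) \<longlonglongrightarrow> complex_of_real (L - ?n)"
  proof -
    have sI: "(\<lambda>k. matrix_inner \<phi> (s k) ?I) \<longlonglongrightarrow> of_nat CARD('n)"
      using rep[of "\<chi> i. nc_var i"] by (simp add: J_var f_var s_def)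
    have "(\<lambda>k. matrix_inner \<phi> (s k) (s k) - matrix_inner \<phi> (s k) ?I
        - cnj (matrix_inner \<phi> (s k) ?I) + of_nat CARD('n))
        \<longlonglongrightarrow> complex_of_real L - of_nat CARD('n) - cnj (of_nat CARD('n)) + of_nat CARD('n)"
      by (intro tendsto_intros sI) (simp add: s_def L)
    moreover have "matrix_inner \<phi> (s k - ?I) (s k - ?I) =
        matrix_inner \<phi> (s k) (s k) - matrix_inner \<phi> (s k) ?I
        - cnj (matrix_inner \<phi> (s k) ?I) + of_nat CARD('n)" for k
    proof -
      have "s k \<in> ?E" by (simp add: s_def J_mem)
      then show ?thesis
        using mat.ip_commute[of "s k" ?I]
        by (simp add: mat.ip_diff_left mat.ip_diff_right mat.diff_mem I_mem matrix_inner_id)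
    qed
    ultimately show ?thesis by simp
  qed
  moreover have diff: "(\<lambda>k. s k - ?I) \<in> form_cauchy ?E (matrix_inner \<phi>)"
    by (intro mat.form_cauchy_diff mat.form_cauchy_const I_mem s)
  ultimately have norm: "completion_norm (matrix_inner \<phi>) (?rel `` {\<lambda>k. s k - ?I}) = sqrt (L - ?n)"
    using mat.completion_inner_eq[OF diff diff] by (simp add: completion_norm_def)
  have "0 \<le> L - ?n" using mat.completion_norm_nonneg[OF diff] norm by simp
  then have "(completion_norm (matrix_inner \<phi>) (?rel `` {\<lambda>k. s k - ?I}))\<^sup>2 \<le> ?n * (c - 1)"
    unfolding norm using L(2) by (simp add: right_diff_distrib)
  then show thesis
    using that[OF stein] mat.completion_diff_eq[OF s mat.form_cauchy_const[OF I_mem]]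
    by (simp add: completion_embed_def)
qed

text \<open>
  The discrepancy is squared in the final estimate, and squaring is monotone only on nonnegative values.
\<close>

lemma free_stein_discrepancy_nonneg:
  fixes X :: "'h bop ^ 'n::finite"
  shows "0 \<le> free_stein_discrepancy M \<phi> X V"
  unfolding free_stein_discrepancy_def
proof (rule INF_greatest)
  let ?E = "tensor_matrices M :: ('h tensor_rep ^ 'n ^ 'n) set"
  interpret mat: semi_inner_space ?E "\<lambda>z A. \<chi> i j. pm_scale z (A $ i $ j)" "matrix_inner \<phi>"
    by (rule semi_inner_space_matrices)
  fix A assume "A \<in> {A. free_stein_kernel M \<phi> X V A}"
  then obtain s where s: "s \<in> form_cauchy ?E (matrix_inner \<phi>)"
    and A: "A = form_rel ?E (matrix_inner \<phi>) `` {s}"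
    by (auto simp: free_stein_kernel_def L2_matrices_def completion_def elim: quotientE)
  have "matrix_id \<in> ?E"
    by (auto simp: matrix_id_def tensor_matrices_def tensor_algebra_def id_mem)
  note c = mat.form_cauchy_const[OF this]
  show "0 \<le> ereal (completion_norm (matrix_inner \<phi>) (completion_diff ?E (matrix_inner \<phi>) A
      (completion_embed ?E (matrix_inner \<phi>) matrix_id)))"
    using mat.completion_norm_nonneg[OF mat.form_cauchy_diff[OF s c]]
    by (simp add: A completion_embed_def mat.completion_diff_eq[OF s c])
qed

end

theorem corollary3p4:
  fixes M :: "'h::complex_hilbert_space bop set"
    and \<phi> :: "'h bop \<Rightarrow> complex"
    and X :: "'h bop ^ 'n::finite"
  assumes "von_neumann_algebra M"
    and "state_on M \<phi>" and "faithful_on M \<phi>" and "normal_on M \<phi>"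
    and "\<And>i. X $ i \<in> M"
    and "\<And>i. self_adjoint (X $ i)"
    and "\<And>i. \<phi> (X $ i) = 0"
    and "(\<Sum>i\<in>UNIV. \<phi> (X $ i o\<^sub>L X $ i)) = of_nat CARD('n)"
  shows "C_opt \<phi> X \<ge>
    1 + (free_stein_discrepancy M \<phi> X (pm_scale (1/2) (\<Sum>i\<in>UNIV. nc_var i ^ 2)))\<^sup>2
          / ereal (real CARD('n))"
  unfolding C_opt_def
proof (rule INF_greatest)
  fix c assume "c \<in> {c. free_poincare \<phi> X c}"
  then have poincare: "free_poincare \<phi> X c" by simp
  interpret vn_algebra_with_state M \<phi> by unfold_locales (rule assms)+
  let ?n = "real CARD('n)" and ?V = "pm_scale (1/2) (\<Sum>i\<in>UNIV. nc_var i ^ 2) :: 'n nc_poly"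
  let ?E = "tensor_matrices M :: ('h tensor_rep ^ 'n ^ 'n) set"
  let ?dist = "\<lambda>A. completion_norm (matrix_inner \<phi>) (completion_diff ?E (matrix_inner \<phi>) A
    (completion_embed ?E (matrix_inner \<phi>) matrix_id))"
  have normalized: "tuple_inner \<phi> X X = of_nat CARD('n)"
    using assms(8) by (simp add: tuple_inner_def self_adjoint_op_adjoint assms(6))
  obtain A where A: "free_stein_kernel M \<phi> X ?V A" and dist: "(?dist A)\<^sup>2 \<le> ?n * (c - 1)"
    using stein_kernel_of_poincare[OF assms(5,7) normalized poincare cyclic_gradient_quadratic]
    by blast
  have le: "free_stein_discrepancy M \<phi> X ?V \<le> ereal (?dist A)"
    unfolding free_stein_discrepancy_def by (rule INF_lower) (simp add: A)
  then obtain r where r: "free_stein_discrepancy M \<phi> X ?V = ereal r" "0 \<le> r" "r \<le> ?dist A"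
    using free_stein_discrepancy_nonneg[of X ?V]
    by (cases "free_stein_discrepancy M \<phi> X ?V") auto
  have "r\<^sup>2 \<le> ?n * (c - 1)"
    using power_mono[OF r(3,2), of 2] dist by linarith
  then have "1 + r\<^sup>2 / ?n \<le> c" by (simp add: field_simps)
  then show "1 + (free_stein_discrepancy M \<phi> X ?V)\<^sup>2 / ereal ?n \<le> ereal c"
    by (simp add: r(1) one_ereal_def)
qed

end
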